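(* Let $(K,v)$ be a valued field, $\overline{K}$ an algebraic closure of $K$, $\overline{v}$ an extension of $v$ to $\overline{K}$, and $X$ transcendental over $K$. Let $w$ be a valuation transcendental extension of $v$ to $K(X)$ and let $(a,\gamma)$ be a minimal pair of definition for $(K(X)|K,w)$. Assume that $(K,v)$ is dense in its henselization $K^h$. Then $$\overline{v}_{a',\gamma}|_{K(X)}=w\quad\text{for all conjugates }a'\text{ of }a\text{ over }K.$$ In particular, this conclusion holds whenever $(K,v)$ has rank one.
   Context: Valuations are written additively; $vK$ and $Kv$ denote value group and residue field. An extension $w$ of $v$ to $K(X)$ is valuation transcendental if $\dim_{\mathbb{Q}}\left(\mathbb{Q}\otimes_{\mathbb{Z}} (wK(X)/vK)\right)+\mathrm{trdeg}[K(X)w:Kv]=1$. For $a\in\overline{K}$ and $\gamma$ in an ordered abelian group containing $\overline{v}\overline{K}$, $\overline{v}_{a,\gamma}$ is the valuation on $\overline{K}(X)$ with $\overline{v}_{a,\gamma}\left(\sum_i c_i(X-a)^i\right)=\min_i\{\overline{v}c_i+i\gamma\}$ for $c_i\in\overline{K}$. $(a,\gamma)$ is a pair of definition for $(K(X)|K,w)$ if $\overline{v}_{a,\gamma}|_{K(X)}=w$. It is a minimal pair of definition if moreover, for all $b\in\overline{K}$, $\overline{v}(a-b)\geq\gamma$ implies $[K(a):K]\leq[K(b):K]$. $K^h$ is the henselization of $(K,v)$ inside $(\overline{K},\overline{v})$. A valued field $(K,v)$ is dense in an extension $(K',v')$ if for every $\delta\in v'K'$ and $c'\in K'$ there is $c\in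 K$ with $v'(c-c')>\delta$.
   Formalization: The formal theorem adds the assumption that (K,v) is henselian or γ is at most some value of a nonzero element of the algebraic closure; without it the claim fails, e.g. for K=ℚ with the 7-adic valuation, a=√2 and γ larger than all values. *)

theory Defs
  imports
    "HOL-Algebra.Algebra"
    "HOL-Algebra.Algebraic_Closure_Type"
    "HOL-Library.Extended_Nat"
    "Jordan_Normal_Form.Missing_VectorSpace"
begin

text \<open>
  All fields are subfields (sets) of a field given by a type, the latter viewed as a ring structure
  via \<^const>\<open>ring_of_type_algebra\<close>. A valuation is written additively with values in a linearly
  ordered abelian group; only its values on nonzero elements matter, and the convention
  \<open>v 0 = \<infinity>\<close> is built into the definitions below by treating \<open>0\<close> separately.
\<close>

locale valued_field =
  fixes F :: "'f :: field set" and v :: "'f \<Rightarrow> 'g :: linordered_ab_group_add"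
  assumes is_subfield: "subfield F ring_of_type_algebra"
    and val_mult: "\<lbrakk>x \<in> F; y \<in> F; x \<noteq> 0; y \<noteq> 0\<rbrakk> \<Longrightarrow> v (x * y) = v x + v y"
    and val_add: "\<lbrakk>x \<in> F; y \<in> F; x \<noteq> 0; y \<noteq> 0; x + y \<noteq> 0\<rbrakk> \<Longrightarrow> min (v x) (v y) \<le> v (x + y)"

definition agree_on :: "'f :: field set \<Rightarrow> ('f \<Rightarrow> 'g) \<Rightarrow> ('f \<Rightarrow> 'g) \<Rightarrow> bool" where
  "agree_on F v v' \<longleftrightarrow> (\<forall>x \<in> F - {0}. v x = v' x)"


subsection \<open>Value groups, rank, rational rank\<close>

definition value_group :: "'f :: field set \<Rightarrow> ('f \<Rightarrow> 'g :: linordered_ab_group_add) \<Rightarrow> 'g monoid" where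
  "value_group F v = \<lparr>carrier = v ` (F - {0}), monoid.mult = (+), one = 0\<rparr>"

definition convex_subgroup :: "'g :: linordered_ab_group_add set \<Rightarrow> 'g monoid \<Rightarrow> bool" where
  "convex_subgroup H G \<longleftrightarrow>
     subgroup H G \<and> (\<forall>x \<in> carrier G. \<forall>y \<in> H. \<forall>z \<in> H. y \<le> x \<and> x \<le> z \<longrightarrow> x \<in> H)"

definition rank_one :: "'f :: field set \<Rightarrow> ('f \<Rightarrow> 'g :: linordered_ab_group_add) \<Rightarrow> bool" where
  "rank_one F v \<longleftrightarrow>
     card {H. convex_subgroup H (value_group F v) \<and> H \<noteq> carrier (value_group F v)} = 1"

text \<open>
  The \<open>\<rat>\<close>-vector space \<open>\<rat> \<otimes>\<^sub>\<int> A\<close> of an abelian group \<open>A\<close>: the free abelian group on the symbols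
  \<open>(q, x)\<close> modulo the subgroup generated by the biadditivity relations. The scalar \<open>q\<close> acts by
  \<open>(r, x) \<mapsto> (q r, x)\<close>. The fields \<open>mult\<close> and \<open>one\<close> of the module record are irrelevant.
\<close>

definition tensor_relations :: "'b monoid \<Rightarrow> (rat \<times> 'b \<Rightarrow>\<^sub>0 int) set" where
  "tensor_relations A =
     {frag_of (q + r, x) - frag_of (q, x) - frag_of (r, x) | q r x. x \<in> carrier A} \<union>
     {frag_of (q, x \<otimes>\<^bsub>A\<^esub> y) - frag_of (q, x) - frag_of (q, y) | q x y.
        x \<in> carrier A \<and> y \<in> carrier A}"

definition rat_tensor :: "'b monoid \<Rightarrow> (rat, (rat \<times> 'b \<Rightarrow>\<^sub>0 int) set) module" where
  "rat_tensor A =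
     (let S = free_Abelian_group (UNIV \<times> carrier A);
          N = generate S (tensor_relations A);
          T = S Mod N
      in \<lparr>carrier = carrier T, monoid.mult = (\<lambda>_ _. \<one>\<^bsub>T\<^esub>), one = \<one>\<^bsub>T\<^esub>,
          ring.zero = \<one>\<^bsub>T\<^esub>, add = (\<lambda>C D. C \<otimes>\<^bsub>T\<^esub> D),
          module.smult = (\<lambda>q C. \<Union>z \<in> C. N #>\<^bsub>S\<^esub> frag_extend (\<lambda>(r, x). frag_of (q * r, x)) z)\<rparr>)"

definition rat_dim :: "(rat, 'b) module \<Rightarrow> enat" where
  "rat_dim V = (if vectorspace.fin_dim ring_of_type_algebra V
                then enat (vectorspace.dim ring_of_type_algebra V) else \<infinity>)"


subsection \<open>Residue fields, transcendence degree\<close>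

definition val_ring :: "'f :: field set \<Rightarrow> ('f \<Rightarrow> 'g :: linordered_ab_group_add) \<Rightarrow> 'f set" where
  "val_ring F v = {x \<in> F. x = 0 \<or> 0 \<le> v x}"

definition val_ideal :: "'f :: field set \<Rightarrow> ('f \<Rightarrow> 'g :: linordered_ab_group_add) \<Rightarrow> 'f set" where
  "val_ideal F v = {x \<in> F. x = 0 \<or> 0 < v x}"

definition residue_field ::
    "'f :: field set \<Rightarrow> ('f \<Rightarrow> 'g :: linordered_ab_group_add) \<Rightarrow> 'f set ring" where
  "residue_field F v = ring_of_type_algebra\<lparr>carrier := val_ring F v\<rparr> Quot val_ideal F v"

text \<open>The residue field of a subfield \<open>E\<close> of \<open>F\<close>, embedded in the residue field of \<open>F\<close>.\<close>

definition residue_subfield ::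
    "'f :: field set \<Rightarrow> 'f set \<Rightarrow> ('f \<Rightarrow> 'g :: linordered_ab_group_add) \<Rightarrow> 'f set set" where
  "residue_subfield E F v = (\<lambda>c. val_ideal F v +>\<^bsub>ring_of_type_algebra\<^esub> c) ` val_ring E v"

text \<open>
  No nonzero polynomial over \<open>k\<close> in variables indexed by the finite set \<open>B\<close> vanishes at \<open>B\<close>; its
  monomials are the exponent functions in \<open>M\<close>, its coefficients are given by \<open>c\<close>.
\<close>

definition alg_independent :: "('r, 'm) ring_scheme \<Rightarrow> 'r set \<Rightarrow> 'r set \<Rightarrow> bool" where
  "alg_independent R k B \<longleftrightarrow> finite B \<and> B \<subseteq> carrier R \<and>
     (\<forall>M c. finite M \<and> M \<subseteq> (B \<rightarrow>\<^sub>E (UNIV :: nat set)) \<and> c \<in> M \<rightarrow> k \<and>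
        (\<Oplus>\<^bsub>R\<^esub>e\<in>M. c e \<otimes>\<^bsub>R\<^esub> (\<Otimes>\<^bsub>R\<^esub>b\<in>B. b [^]\<^bsub>R\<^esub> e b)) = \<zero>\<^bsub>R\<^esub>
        \<longrightarrow> (\<forall>e\<in>M. c e = \<zero>\<^bsub>R\<^esub>))"

definition trdeg :: "('r, 'm) ring_scheme \<Rightarrow> 'r set \<Rightarrow> enat" where
  "trdeg R k = (SUP B \<in> {B. alg_independent R k B}. enat (card B))"

definition valuation_transcendental ::
    "'f :: field set \<Rightarrow> 'f set \<Rightarrow> ('f \<Rightarrow> 'g :: linordered_ab_group_add) \<Rightarrow> bool" where
  "valuation_transcendental E F w \<longleftrightarrow>
     rat_dim (rat_tensor (value_group F w Mod carrier (value_group E w)))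
       + trdeg (residue_field F w) (residue_subfield E F w) = 1"


subsection \<open>The field \<open>K(X)\<close> and the valuations \<open>v\<^sub>a\<^sub>,\<^sub>\<gamma>\<close>\<close>

text \<open>For a subfield \<open>K\<close> of \<open>'a\<close>, its rational function field inside \<^typ>\<open>'a poly fract\<close>.\<close>

definition polys_over :: "'a :: field set \<Rightarrow> 'a poly set" where
  "polys_over K = {f. \<forall>i. Polynomial.coeff f i \<in> K}"

definition rat_funs :: "'a :: field set \<Rightarrow> 'a poly fract set" where
  "rat_funs K = {Fraction_Field.Fract f g | f g. f \<in> polys_over K \<and> g \<in> polys_over K \<and> g \<noteq> 0}"

definition const_fun :: "'a :: field \<Rightarrow> 'a poly fract" where
  "const_fun c = Fraction_Field.Fract [:c:] 1"

definition taylor_coeff :: "'a :: field \<Rightarrow> 'a poly \<Rightarrow> nat \<Rightarrow> 'a" where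
  "taylor_coeff a f i = Polynomial.coeff (f \<circ>\<^sub>p [:a, 1:]) i"

lemma taylor_expansion:
  fixes a :: "'a :: field"
  shows "f = (\<Sum>i\<le>Polynomial.degree f. Polynomial.smult (taylor_coeff a f i) ([:- a, 1:] ^ i))"
proof -
  have "f = (f \<circ>\<^sub>p [:a, 1:]) \<circ>\<^sub>p [:- a, 1:]"
    by (simp add: pcompose_assoc [symmetric] pcompose_pCons)
  also have "\<dots> = (\<Sum>i\<le>Polynomial.degree (f \<circ>\<^sub>p [:a, 1:]). Polynomial.smult (taylor_coeff a f i) ([:- a, 1:] ^ i))"
  proof -
    have "g \<circ>\<^sub>p q = (\<Sum>i\<le>Polynomial.degree g. Polynomial.smult (Polynomial.coeff g i) (q ^ i))" for g q :: "'a poly"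
      by (simp add: pcompose_altdef poly_altdef coeff_map_poly degree_map_poly)
    then show ?thesis by (simp add: taylor_coeff_def)
  qed
  also have "Polynomial.degree (f \<circ>\<^sub>p [:a, 1:]) = Polynomial.degree f" by (simp add: degree_pcompose)
  finally show ?thesis .
qed

definition gauss_val_poly ::
    "('a :: field \<Rightarrow> 'g :: linordered_ab_group_add) \<Rightarrow> 'a \<Rightarrow> 'g \<Rightarrow> 'a poly \<Rightarrow> 'g" where
  "gauss_val_poly v a \<gamma> f =
     Min {v (taylor_coeff a f i) + (\<Sum>j<i. \<gamma>) | i. taylor_coeff a f i \<noteq> 0}"

definition gauss_val ::
    "('a :: field \<Rightarrow> 'g :: linordered_ab_group_add) \<Rightarrow> 'a \<Rightarrow> 'g \<Rightarrow> 'a poly fract \<Rightarrow> 'g" where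
  "gauss_val v a \<gamma> r =
     (THE d. \<exists>f g. f \<noteq> 0 \<and> g \<noteq> 0 \<and> r = Fraction_Field.Fract f g \<and>
                   d = gauss_val_poly v a \<gamma> f - gauss_val_poly v a \<gamma> g)"


subsection \<open>Pairs of definition\<close>

definition pair_of_definition ::
    "'a :: field set \<Rightarrow> ('a \<Rightarrow> 'g :: linordered_ab_group_add) \<Rightarrow> ('a poly fract \<Rightarrow> 'g)
       \<Rightarrow> 'a \<Rightarrow> 'g \<Rightarrow> bool" where
  "pair_of_definition K vb w a \<gamma> \<longleftrightarrow> agree_on (rat_funs K) (gauss_val vb a \<gamma>) w"

definition degree_over :: "'a :: field set \<Rightarrow> 'a \<Rightarrow> nat" where
  "degree_over K a = ring.dim ring_of_type_algebra K (generate_field ring_of_type_algebra (insert a K))"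

definition minimal_pair_of_definition ::
    "'a :: field set \<Rightarrow> ('a \<Rightarrow> 'g :: linordered_ab_group_add) \<Rightarrow> ('a poly fract \<Rightarrow> 'g)
       \<Rightarrow> 'a \<Rightarrow> 'g \<Rightarrow> bool" where
  "minimal_pair_of_definition K vb w a \<gamma> \<longleftrightarrow> pair_of_definition K vb w a \<gamma> \<and>
     (\<forall>b. a - b = 0 \<or> \<gamma> \<le> vb (a - b) \<longrightarrow> degree_over K a \<le> degree_over K b)"

text \<open>For algebraic \<open>a\<close>: \<open>a'\<close> is a root of the minimal polynomial of \<open>a\<close> over \<open>K\<close>.\<close>

definition conjugate_over :: "'a :: field set \<Rightarrow> 'a \<Rightarrow> 'a \<Rightarrow> bool" where
  "conjugate_over K a a' \<longleftrightarrow> (\<forall>f \<in> polys_over K. poly f a = 0 \<longrightarrow> poly f a' = 0)"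


subsection \<open>Henselization and density\<close>

text \<open>
  Here \<open>vb\<close> is a valuation on an algebraic closure of \<open>L\<close>. The valued field \<open>(L, vb|\<^sub>L)\<close> is henselian
  iff \<open>vb\<close> is the only extension of \<open>vb|\<^sub>L\<close> to that algebraic closure. It suffices to consider
  extensions with values in the same type \<open>'g\<close>: every extension is equivalent to some
  \<open>vb \<circ> \<sigma>\<close>, with \<open>\<sigma>\<close> an automorphism over \<open>L\<close>.
\<close>

definition henselian :: "('a :: field \<Rightarrow> 'g :: linordered_ab_group_add) \<Rightarrow> 'a set \<Rightarrow> bool" where
  "henselian vb L \<longleftrightarrow>
     (\<forall>v'. valued_field UNIV v' \<and> agree_on L v' vb \<longrightarrow> agree_on UNIV v' vb)"

text \<open>The henselization of \<open>K\<close> inside the valued algebraic closure: the least henselian field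
  containing \<open>K\<close>.\<close>

definition is_henselization ::
    "('a :: field \<Rightarrow> 'g :: linordered_ab_group_add) \<Rightarrow> 'a set \<Rightarrow> 'a set \<Rightarrow> bool" where
  "is_henselization vb K Kh \<longleftrightarrow>
     subfield Kh ring_of_type_algebra \<and> K \<subseteq> Kh \<and> henselian vb Kh \<and>
     (\<forall>L. subfield L ring_of_type_algebra \<and> K \<subseteq> L \<and> henselian vb L \<longrightarrow> Kh \<subseteq> L)"

definition dense_in ::
    "('f :: field \<Rightarrow> 'g :: linordered_ab_group_add) \<Rightarrow> 'f set \<Rightarrow> 'f set \<Rightarrow> bool" where
  "dense_in v K L \<longleftrightarrow>
     (\<forall>\<delta> \<in> v ` (L - {0}). \<forall>c' \<in> L. \<exists>c \<in> K. c - c' = 0 \<or> \<delta> < v (c - c'))"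


subsection \<open>Infinitely large \<open>\<gamma>\<close>\<close>

text \<open>
  In a larger ordered group \<open>\<gamma>\<close> may exceed every element of the value group of \<open>vb\<close>, and then
  density of \<open>K\<close> in its henselization does not make the valuations \<open>v\<^sub>a\<^sub>',\<^sub>\<gamma>\<close> agree on \<open>K(X)\<close> for all
  conjugates \<open>a'\<close> of \<open>a\<close>. Take \<open>K = \<rat>\<close> with the \<open>7\<close>-adic valuation, which has rank one,
  \<open>a = \<surd>2\<close>, and \<open>\<gamma>\<close> larger than all values. Only \<open>b = a\<close> satisfies \<open>vb (a - b) \<ge> \<gamma>\<close>, so \<open>(a, \<gamma>)\<close> is a
  minimal pair of definition for its restriction \<open>w\<close> to \<open>\<rat>(X)\<close>, and \<open>w\<close> is valuation
  transcendental since \<open>w (X\<^sup>2 - 2) = \<gamma>\<close>. But \<open>X - 3\<close> has the value \<open>vb (\<surd>2 - 3)\<close> for \<open>a = \<surd>2\<close>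
  and \<open>vb (- \<surd>2 - 3)\<close> for \<open>a' = - \<surd>2\<close>; these differ, as the sum of the two is \<open>1\<close> and one of
  them is \<open>0\<close>. If \<open>K\<close> is henselian, no bound on \<open>\<gamma>\<close> is needed.
\<close>

end

theory Submission
  imports Defs
begin

text \<open>
  Let \<open>L\<close> be a field between \<open>K\<close> and its algebraic closure in which \<open>K\<close> is dense and whose embeddings
  \<open>\<tau>\<close> over \<open>L\<close> all preserve the valuation. The minimal polynomial of \<open>a\<close> over \<open>L\<close> is approximated by a
  polynomial over \<open>K\<close> of the same degree with a root \<open>b\<close> so close to \<open>a\<close> that minimality of \<open>(a, \<gamma>)\<close>
  gives \<open>[K(a) : K] \<le> [K(b) : K] \<le> [L(a) : L]\<close>. Hence every conjugate of \<open>a\<close> over \<open>K\<close> is of the form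
  \<open>\<tau> a\<close>, and \<open>\<tau>\<close> transports \<open>v\<^sub>a\<^sub>,\<^sub>\<gamma>\<close> to \<open>v\<^sub>\<tau>\<^sub>a\<^sub>,\<^sub>\<gamma>\<close> without changing it on \<open>K(X)\<close>.

  If \<open>K\<close> is henselian, \<open>L = K\<close> works without approximation, so \<open>\<gamma>\<close> may be infinitely large. Otherwise
  one takes for \<open>L\<close> the henselization, or, in rank one, the topological closure of \<open>K\<close> in its algebraic
  closure. In the second case, if \<open>\<tau>\<close> changed the value of some \<open>x\<close>, one could choose \<open>u = y\<^sup>q / d\<close>, as a
  function of the conjugates \<open>y\<close> of \<open>x\<close>, with nonzero values whose signs at \<open>x\<close> and \<open>\<tau> x\<close> are opposite;
  the product of the \<open>u\<close> of negative value is a limit of quotients of norms, so it lies in \<open>L\<close> and is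
  fixed by \<open>\<tau>\<close>, although \<open>\<tau>\<close> increases its value.
\<close>


subsection \<open>Subfields and minimal polynomials\<close>

lemma carrier_type_ring [simp]: "carrier (ring_of_type_algebra :: 'a :: field ring) = UNIV"
  and mult_type_ring [simp]: "x \<otimes>\<^bsub>ring_of_type_algebra\<^esub> y = (x * y :: 'a :: field)"
  and add_type_ring [simp]: "x \<oplus>\<^bsub>ring_of_type_algebra\<^esub> y = (x + y :: 'a :: field)"
  and one_type_ring [simp]: "\<one>\<^bsub>ring_of_type_algebra\<^esub> = (1 :: 'a :: field)"
  and zero_type_ring [simp]: "\<zero>\<^bsub>ring_of_type_algebra\<^esub> = (0 :: 'a :: field)"
  by (simp_all add: ring_of_type_algebra_def)

lemma a_inv_type_ring [simp]: "\<ominus>\<^bsub>ring_of_type_algebra\<^esub> x = (- x :: 'a :: field)"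
proof -
  interpret field "ring_of_type_algebra :: 'a ring" by rule
  show ?thesis by (rule minus_equality) auto
qed

lemma m_inv_type_ring [simp]: "x \<noteq> 0 \<Longrightarrow> inv\<^bsub>ring_of_type_algebra\<^esub> x = (inverse x :: 'a :: field)"
proof -
  assume "x \<noteq> 0"
  interpret field "ring_of_type_algebra :: 'a ring" by rule
  show ?thesis using \<open>x \<noteq> 0\<close> by (intro comm_inv_char) auto
qed

text \<open>Closure under \<open>inverse\<close> needs no exception for zero, because
  \<open>inverse 0 = 0\<close>.\<close>

locale closed_field_set =
  fixes K :: "'a :: field set"
  assumes zero_mem [simp]: "0 \<in> K" and one_mem [simp]: "1 \<in> K"
    and add_mem: "x \<in> K \<Longrightarrow> y \<in> K \<Longrightarrow> x + y \<in> K"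
    and mult_mem: "x \<in> K \<Longrightarrow> y \<in> K \<Longrightarrow> x * y \<in> K"
    and uminus_mem: "x \<in> K \<Longrightarrow> - x \<in> K"
    and inverse_mem: "x \<in> K \<Longrightarrow> inverse x \<in> K"

lemma subfield_type_ring_iff:
  "subfield K (ring_of_type_algebra :: 'a :: field ring) \<longleftrightarrow> closed_field_set K"
proof
  interpret R: field "ring_of_type_algebra :: 'a ring" by rule
  assume K: "subfield K (ring_of_type_algebra :: 'a ring)"
  note r = subringE[OF subfieldE(1)[OF K]]
  show "closed_field_set K"
  proof
    fix x assume "x \<in> K"
    show "inverse x \<in> K"
    proof (cases "x = 0")
      case False
      then show ?thesis using R.subfield_m_inv(1)[OF K, of x] \<open>x \<in> K\<close> by simp
    qed (use r(2) in simp)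
  qed (use r in auto)
next
  interpret R: field "ring_of_type_algebra :: 'a ring" by rule
  assume "closed_field_set K"
  then interpret closed_field_set K .
  show "subfield K (ring_of_type_algebra :: 'a ring)"
  proof (rule R.subfieldI')
    show "subring K (ring_of_type_algebra :: 'a ring)"
      by (rule R.subringI) (auto intro: add_mem mult_mem uminus_mem)
  qed (auto intro: inverse_mem)
qed

lemma poly_zero_imp_degree_pos:
  assumes "p \<noteq> 0" "poly p x = 0" shows "Polynomial.degree p > 0"
proof (rule ccontr)
  assume "\<not> 0 < Polynomial.degree p"
  then obtain c where "p = [:c:]" using degree_eq_zeroE[of p] by auto
  then show False using assms by simp
qed

context closed_field_set
begin

lemma diff_mem: "x \<in> K \<Longrightarrow> y \<in> K \<Longrightarrow> x - y \<in> K"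
  using add_mem[of x "- y"] uminus_mem[of y] by simp

lemma divide_mem: "x \<in> K \<Longrightarrow> y \<in> K \<Longrightarrow> x / y \<in> K"
  by (simp add: divide_inverse mult_mem inverse_mem)

lemma power_mem: "x \<in> K \<Longrightarrow> x ^ n \<in> K"
  by (induction n) (auto intro: mult_mem)

lemma sum_mem: "(\<And>i. i \<in> A \<Longrightarrow> f i \<in> K) \<Longrightarrow> sum f A \<in> K"
  by (induction A rule: infinite_finite_induct) (auto intro: add_mem)

lemma prod_mset_mem: "(\<And>x. x \<in># A \<Longrightarrow> f x \<in> K) \<Longrightarrow> (\<Prod>x\<in>#A. f x) \<in> K"
  by (induction A) (auto intro: mult_mem)

lemma coeff_mem: "p \<in> polys_over K \<Longrightarrow> Polynomial.coeff p i \<in> K"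
  by (simp add: polys_over_def)

lemma polys_over_0 [simp]: "0 \<in> polys_over K"
  by (simp add: polys_over_def)

lemma polys_over_pCons: "c \<in> K \<Longrightarrow> p \<in> polys_over K \<Longrightarrow> pCons c p \<in> polys_over K"
  by (auto simp: polys_over_def coeff_pCons split: nat.split)

lemma polys_over_1 [simp]: "1 \<in> polys_over K"
  by (simp add: polys_over_pCons one_pCons)

lemma polys_over_add: "p \<in> polys_over K \<Longrightarrow> q \<in> polys_over K \<Longrightarrow> p + q \<in> polys_over K"
  by (simp add: polys_over_def add_mem)

lemma polys_over_diff: "p \<in> polys_over K \<Longrightarrow> q \<in> polys_over K \<Longrightarrow> p - q \<in> polys_over K"
  by (simp add: polys_over_def diff_mem)

lemma polys_over_smult: "c \<in> K \<Longrightarrow> p \<in> polys_over K \<Longrightarrow> Polynomial.smult c p \<in> polys_over K"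
  by (simp add: polys_over_def mult_mem)

lemma polys_over_mult: "p \<in> polys_over K \<Longrightarrow> q \<in> polys_over K \<Longrightarrow> p * q \<in> polys_over K"
  by (auto simp: polys_over_def coeff_mult intro!: sum_mem mult_mem)

lemma polys_over_power: "p \<in> polys_over K \<Longrightarrow> p ^ n \<in> polys_over K"
  by (induction n) (auto intro: polys_over_mult)

lemma polys_over_monom: "c \<in> K \<Longrightarrow> Polynomial.monom c n \<in> polys_over K"
  by (simp add: polys_over_def)

end

definition algebraic_over :: "'a :: field set \<Rightarrow> 'a \<Rightarrow> bool" where
  "algebraic_over K x \<longleftrightarrow> (\<exists>p \<in> polys_over K. p \<noteq> 0 \<and> poly p x = 0)"

lemma polys_over_mono: "K \<subseteq> L \<Longrightarrow> polys_over K \<subseteq> polys_over L"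
  by (auto simp: polys_over_def)

lemma algebraic_over_mono: "K \<subseteq> L \<Longrightarrow> algebraic_over K x \<Longrightarrow> algebraic_over L x"
  using polys_over_mono unfolding algebraic_over_def by blast

text \<open>Least degree stands in place of irreducibility: division with remainder and the
  comparison of degrees over two base fields use exactly this form.\<close>

definition is_min_poly :: "'a :: field set \<Rightarrow> 'a \<Rightarrow> 'a poly \<Rightarrow> bool" where
  "is_min_poly K x g \<longleftrightarrow> g \<in> polys_over K \<and> Polynomial.lead_coeff g = 1 \<and> poly g x = 0 \<and>
     (\<forall>p \<in> polys_over K. p \<noteq> 0 \<longrightarrow> poly p x = 0 \<longrightarrow> Polynomial.degree g \<le> Polynomial.degree p)"

lemma degree_diff_lead_less:
  fixes p q :: "'a :: comm_ring_1 poly"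
  assumes "Polynomial.degree q = Polynomial.degree p"
    and "Polynomial.lead_coeff q = Polynomial.lead_coeff p" and "p - q \<noteq> 0"
  shows "Polynomial.degree (p - q) < Polynomial.degree p"
proof (cases "Polynomial.degree p = 0")
  case True
  then obtain c d where "p = [:c:]" "q = [:d:]" using assms by (metis degree_eq_zeroE)
  then show ?thesis using assms by simp
next
  case False
  have "Polynomial.degree (p - q) \<le> Polynomial.degree p" using assms degree_diff_le by (metis order_refl)
  moreover have "Polynomial.degree (p - q) \<noteq> Polynomial.degree p"
  proof
    assume "Polynomial.degree (p - q) = Polynomial.degree p"
    then have "Polynomial.lead_coeff (p - q) = 0" using assms(1,2) by simp
    then show False using assms(3) leading_coeff_0_iff by blast
  qed
  ultimately show ?thesis by simp
qed

text \<open>One step of long division. Since \<open>h\<close> is monic, the multiplier only needs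
  the leading coefficient of \<open>p\<close>, so no coefficient leaves the base field.\<close>

lemma monic_cancel_lead:
  fixes p h :: "'a :: field poly"
  assumes "Polynomial.lead_coeff h = 1" "Polynomial.degree h \<le> Polynomial.degree p" "p \<noteq> 0"
  defines "q \<equiv> Polynomial.monom (Polynomial.lead_coeff p) (Polynomial.degree p - Polynomial.degree h)"
  shows "p - q * h = 0 \<or> Polynomial.degree (p - q * h) < Polynomial.degree p"
proof -
  have h: "h \<noteq> 0" using assms by auto
  have q: "q \<noteq> 0" "Polynomial.degree q = Polynomial.degree p - Polynomial.degree h"
    using assms by (auto simp: q_def degree_monom_eq)
  have d: "Polynomial.degree (q * h) = Polynomial.degree p" using h q assms by (simp add: degree_mult_eq)
  have l: "Polynomial.lead_coeff (q * h) = Polynomial.lead_coeff p"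
    using assms by (simp only: lead_coeff_mult) (simp add: q_def degree_monom_eq)
  show ?thesis using degree_diff_lead_less[OF d l] by blast
qed

context closed_field_set
begin

lemma min_poly_exists:
  assumes "algebraic_over K x" obtains g where "is_min_poly K x g"
proof -
  let ?P = "\<lambda>p. p \<in> polys_over K \<and> p \<noteq> 0 \<and> poly p x = 0"
  obtain p0 where "?P p0" using assms by (auto simp: algebraic_over_def)
  then obtain p where p: "?P p" and min: "\<And>q. ?P q \<Longrightarrow> Polynomial.degree p \<le> Polynomial.degree q"
    using ex_has_least_nat[of ?P p0 Polynomial.degree] by blast
  let ?g = "Polynomial.smult (inverse (Polynomial.lead_coeff p)) p"
  have "is_min_poly K x ?g"
    using p min by (auto simp: is_min_poly_def intro!: polys_over_smult inverse_mem coeff_mem)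
  then show ?thesis by (rule that)
qed

lemma monic_division:
  assumes "h \<in> polys_over K" "Polynomial.lead_coeff h = 1" "p \<in> polys_over K"
  shows "\<exists>q r. q \<in> polys_over K \<and> r \<in> polys_over K \<and> p = q * h + r \<and>
    (r = 0 \<or> Polynomial.degree r < Polynomial.degree h)"
  using assms(3)
proof (induction "Polynomial.degree p" arbitrary: p rule: less_induct)
  case less
  show ?case
  proof (cases "p = 0 \<or> Polynomial.degree p < Polynomial.degree h")
    case True
    then show ?thesis using less.prems by (intro exI[of _ 0] exI[of _ p]) auto
  next
    case False
    let ?q = "Polynomial.monom (Polynomial.lead_coeff p) (Polynomial.degree p - Polynomial.degree h)"
    have q: "?q \<in> polys_over K" using less.prems by (intro polys_over_monom coeff_mem)
    have mem: "p - ?q * h \<in> polys_over K"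
      using q less.prems assms by (intro polys_over_diff polys_over_mult)
    have "p - ?q * h = 0 \<or> Polynomial.degree (p - ?q * h) < Polynomial.degree p"
      using monic_cancel_lead[of h p] assms False by auto
    then show ?thesis
    proof
      assume "p - ?q * h = 0"
      then show ?thesis using q by (intro exI[of _ ?q] exI[of _ 0]) auto
    next
      assume "Polynomial.degree (p - ?q * h) < Polynomial.degree p"
      from less.hyps[OF this mem] obtain q1 r where "q1 \<in> polys_over K" "r \<in> polys_over K"
        "p - ?q * h = q1 * h + r" "r = 0 \<or> Polynomial.degree r < Polynomial.degree h" by blast
      then show ?thesis using q
        by (intro exI[of _ "q1 + ?q"] exI[of _ r]) (auto simp: algebra_simps intro: polys_over_add)
    qed
  qed
qed

lemma min_poly_dvd:
  assumes g: "is_min_poly K x g" and p: "p \<in> polys_over K" "poly p x = 0"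
  shows "g dvd p"
proof -
  obtain q r where qr: "q \<in> polys_over K" "r \<in> polys_over K" "p = q * g + r"
    "r = 0 \<or> Polynomial.degree r < Polynomial.degree g"
    using monic_division[of g p] g p unfolding is_min_poly_def by blast
  then have "poly r x = 0" using p g by (simp add: is_min_poly_def)
  then have "r = 0" using qr(2,4) g unfolding is_min_poly_def by (meson not_le)
  then show ?thesis using qr by simp
qed

end

text \<open>Otherwise \<open>X\<close> could be divided out of \<open>g\<close>, leaving a
  polynomial of smaller degree that still vanishes at \<open>x \<noteq> 0\<close>.\<close>

lemma (in closed_field_set) min_poly_coeff_0:
  assumes g: "is_min_poly K x g" and "x \<noteq> 0"
  shows "Polynomial.coeff g 0 \<noteq> 0"
proof
  obtain c q where gq: "g = pCons c q" by (cases g)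
  assume "Polynomial.coeff g 0 = 0"
  then have c: "c = 0" by (simp add: gq)
  have "q \<in> polys_over K"
    using g coeff_mem[of g "Suc _"] by (auto simp: is_min_poly_def gq polys_over_def)
  moreover have "poly q x = 0" "q \<noteq> 0" using g c \<open>x \<noteq> 0\<close> by (auto simp: is_min_poly_def gq)
  ultimately have "Polynomial.degree g \<le> Polynomial.degree q" using g by (auto simp: is_min_poly_def)
  then show False using \<open>q \<noteq> 0\<close> by (simp add: gq)
qed

subsection \<open>Embeddings over a base field\<close>

text \<open>
  Isomorphisms over \<open>L\<close> between subrings are represented by their graphs, so that a chain of them
  has its union as an upper bound.
\<close>

definition embedding_graph :: "'a :: field set \<Rightarrow> ('a \<times> 'a) set \<Rightarrow> bool" where
  "embedding_graph L S \<longleftrightarrow> (\<forall>c \<in> L. (c, c) \<in> S) \<and>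
     (\<forall>x x' y y'. (x, x') \<in> S \<longrightarrow> (y, y') \<in> S \<longrightarrow> (x + y, x' + y') \<in> S \<and> (x * y, x' * y') \<in> S) \<and>
     (\<forall>y. (0, y) \<in> S \<longrightarrow> y = 0)"

definition poly_rel :: "('a :: field \<times> 'a) set \<Rightarrow> 'a poly \<Rightarrow> 'a poly \<Rightarrow> bool" where
  "poly_rel S p p' \<longleftrightarrow> (\<forall>i. (Polynomial.coeff p i, Polynomial.coeff p' i) \<in> S)"

text \<open>The candidate extension sending \<open>x\<close> to \<open>x'\<close>. As a mere
  relation it always exists; that it is single-valued is a separate matter.\<close>

definition adjoin :: "('a :: field \<times> 'a) set \<Rightarrow> 'a \<Rightarrow> 'a \<Rightarrow> ('a \<times> 'a) set" where
  "adjoin S x x' = {(poly p x, poly p' x') | p p'. poly_rel S p p'}"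

locale algebraic_embedding_graph = closed_field_set L for L :: "'a :: field set" +
  fixes S :: "('a \<times> 'a) set"
  assumes emb: "embedding_graph L S"
    and algebraic: "algebraic_over L x"
begin

lemma refl_mem: "c \<in> L \<Longrightarrow> (c, c) \<in> S"
  using emb by (simp add: embedding_graph_def)

lemma pair_add: "(x, x') \<in> S \<Longrightarrow> (y, y') \<in> S \<Longrightarrow> (x + y, x' + y') \<in> S"
  using emb by (simp add: embedding_graph_def)

lemma pair_mult: "(x, x') \<in> S \<Longrightarrow> (y, y') \<in> S \<Longrightarrow> (x * y, x' * y') \<in> S"
  using emb by (simp add: embedding_graph_def)

lemma pair_diff: "(x, x') \<in> S \<Longrightarrow> (y, y') \<in> S \<Longrightarrow> (x - y, x' - y') \<in> S"
  using pair_add[OF _ pair_mult[OF refl_mem[of "- 1"]], of x x' y y'] by (simp add: uminus_mem)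

lemma pair_0: "(0, 0) \<in> S" and pair_1: "(1, 1) \<in> S"
  by (simp_all add: refl_mem)

text \<open>The difference of two pairs with the same first entry is \<open>(0, x' - x'')\<close>,
  and only zero is paired with zero.\<close>

lemma pair_unique: "(x, x') \<in> S \<Longrightarrow> (x, x'') \<in> S \<Longrightarrow> x' = x''"
  using pair_diff[of x x' x x''] emb unfolding embedding_graph_def
  by (metis cancel_comm_monoid_add_class.diff_cancel eq_iff_diff_eq_0)

lemma pair_sum: "(\<And>i. i \<in> A \<Longrightarrow> (f i, f' i) \<in> S) \<Longrightarrow> (sum f A, sum f' A) \<in> S"
  by (induction A rule: infinite_finite_induct) (auto intro: pair_add pair_0)

lemma pair_power: "(x, x') \<in> S \<Longrightarrow> (x ^ n, x' ^ n) \<in> S"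
  by (induction n) (auto intro: pair_mult pair_1)

lemma poly_rel_refl: "p \<in> polys_over L \<Longrightarrow> poly_rel S p p"
  by (simp add: poly_rel_def polys_over_def refl_mem)

lemma poly_rel_mult: "poly_rel S p p' \<Longrightarrow> poly_rel S q q' \<Longrightarrow> poly_rel S (p * q) (p' * q')"
  by (auto simp: poly_rel_def coeff_mult intro!: pair_sum pair_mult)

lemma poly_rel_add: "poly_rel S p p' \<Longrightarrow> poly_rel S q q' \<Longrightarrow> poly_rel S (p + q) (p' + q')"
  by (auto simp: poly_rel_def intro!: pair_add)

lemma poly_rel_diff: "poly_rel S p p' \<Longrightarrow> poly_rel S q q' \<Longrightarrow> poly_rel S (p - q) (p' - q')"
  by (auto simp: poly_rel_def intro!: pair_diff)

lemma poly_rel_monom: "(c, c') \<in> S \<Longrightarrow> poly_rel S (Polynomial.monom c n) (Polynomial.monom c' n)"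
  by (auto simp: poly_rel_def pair_0)

lemma pair_poly:
  assumes p: "p \<in> polys_over L" and x: "(x, x') \<in> S"
  shows "(poly p x, poly p x') \<in> S"
  unfolding poly_altdef using p x by (auto intro!: pair_sum pair_mult pair_power refl_mem simp: polys_over_def)

text \<open>If \<open>c + X q\<close> is the minimal polynomial of \<open>x\<close> over
  \<open>L\<close>, then \<open>- q(x) / c\<close> is the inverse of \<open>x\<close>. It is a
  polynomial in \<open>x\<close> over \<open>L\<close>, so the ring operations of the graph already
  yield inverses.\<close>

lemma pair_inverse:
  assumes x: "(x, x') \<in> S" shows "(inverse x, inverse x') \<in> S"
proof (cases "x = 0")
  case True
  then have "x' = 0" using x pair_unique[OF _ pair_0] by blast
  then show ?thesis using True pair_0 by simp
next
  case False
  obtain g where g: "is_min_poly L x g" using min_poly_exists algebraic by blast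
  obtain c q where gq: "g = pCons c q" by (cases g)
  have cq: "c \<in> L" "q \<in> polys_over L"
    using g coeff_mem[of g 0] coeff_mem[of g "Suc _"] by (auto simp: is_min_poly_def gq polys_over_def)
  have c: "c \<noteq> 0" using min_poly_coeff_0[OF g False] by (simp add: gq)
  define y y' where "y = - inverse c * poly q x" and "y' = - inverse c * poly q x'"
  have yy: "(y, y') \<in> S"
    unfolding y_def y'_def by (intro pair_mult pair_poly cq x refl_mem uminus_mem inverse_mem)
  have "c + x * poly q x = 0" using g by (simp add: is_min_poly_def gq)
  then have eq: "poly q x * x = - c" by (simp add: algebra_simps eq_neg_iff_add_eq_0)
  have "y * x = 1" using c by (simp add: y_def mult.assoc eq)
  moreover from this have "y' * x' = 1"
    using pair_unique[OF pair_mult[OF yy x], of 1] pair_1 by simp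
  ultimately show ?thesis using yy by (metis inverse_unique mult.commute)
qed

text \<open>Parallel division: a multiple of \<open>h\<close> is subtracted from \<open>p\<close>
  and the corresponding multiple of \<open>h'\<close> from \<open>p'\<close>. The results remain
  related, the degree of \<open>p\<close> falls, and the values at \<open>x\<close> and
  \<open>x'\<close> do not change.\<close>

lemma adjoin_single_valued:
  assumes h: "poly_rel S h h'" "Polynomial.lead_coeff h = 1"
    and min: "\<And>p p'. poly_rel S p p' \<Longrightarrow> p \<noteq> 0 \<Longrightarrow> poly p x = 0 \<Longrightarrow> Polynomial.degree h \<le> Polynomial.degree p"
    and root: "poly h x = 0" "poly h' x' = 0"
    and p: "poly_rel S p p'" "poly p x = 0"
  shows "poly p' x' = 0"
  using p
proof (induction "Polynomial.degree p" arbitrary: p p' rule: less_induct)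
  case less
  have zero: "q' = 0" if "poly_rel S 0 q'" for q'
    using that pair_unique[OF _ pair_0] by (auto simp: poly_rel_def poly_eq_iff)
  show ?case
  proof (cases "p = 0")
    case True
    then have "p' = 0" using zero less.prems by blast
    then show ?thesis by simp
  next
    case False
    define n where "n = Polynomial.degree p - Polynomial.degree h"
    \<comment> \<open>The second coefficient is read off at the degree of \<open>p\<close>, not of
      \<open>p'\<close>, so that it is the partner of the first.\<close>
    define q q' where "q = Polynomial.monom (Polynomial.lead_coeff p) n"
      and "q' = Polynomial.monom (Polynomial.coeff p' (Polynomial.degree p)) n"
    have qq: "poly_rel S q q'"
      unfolding q_def q'_def using less.prems by (intro poly_rel_monom) (simp add: poly_rel_def)
    have rel: "poly_rel S (p - q * h) (p' - q' * h')"
      by (intro poly_rel_diff poly_rel_mult less.prems qq h)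
    have 0: "poly (p - q * h) x = 0" using less.prems root by simp
    have "p - q * h = 0 \<or> Polynomial.degree (p - q * h) < Polynomial.degree p"
      unfolding q_def n_def by (rule monic_cancel_lead) (use h min less.prems False in auto)
    then have "poly (p' - q' * h') x' = 0"
    proof
      assume "p - q * h = 0"
      then have "p' - q' * h' = 0" using zero rel by metis
      then show ?thesis by simp
    next
      assume "Polynomial.degree (p - q * h) < Polynomial.degree p"
      from less.hyps[OF this rel 0] show ?thesis .
    qed
    then show ?thesis using root by simp
  qed
qed

lemma adjoin_incl: "S \<subseteq> adjoin S x x'"
proof
  fix z assume "z \<in> S"
  then have "poly_rel S [:fst z:] [:snd z:]"
    by (auto simp: poly_rel_def coeff_pCons pair_0 split: nat.split)
  then show "z \<in> adjoin S x x'"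
    unfolding adjoin_def by (intro CollectI exI[of _ "[:fst z:]"] exI[of _ "[:snd z:]"]) simp
qed

lemma adjoin_mem: "(x, x') \<in> adjoin S x x'"
proof -
  have "poly_rel S [:0, 1:] [:0, 1:]"
    by (intro poly_rel_refl polys_over_pCons) auto
  then show ?thesis unfolding adjoin_def by (intro CollectI exI[of _ "[:0, 1:]"]) simp
qed

lemma embedding_graph_adjoin:
  assumes "poly_rel S h h'" "Polynomial.lead_coeff h = 1"
    and "\<And>p p'. poly_rel S p p' \<Longrightarrow> p \<noteq> 0 \<Longrightarrow> poly p x = 0 \<Longrightarrow> Polynomial.degree h \<le> Polynomial.degree p"
    and "poly h x = 0" "poly h' x' = 0"
  shows "embedding_graph L (adjoin S x x')"
  unfolding embedding_graph_def
proof (intro conjI ballI allI impI)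
  fix c assume "c \<in> L"
  then show "(c, c) \<in> adjoin S x x'" using adjoin_incl refl_mem by blast
next
  fix y y' z z' assume "(y, y') \<in> adjoin S x x'" "(z, z') \<in> adjoin S x x'"
  then obtain p p' q q' where pq: "poly_rel S p p'" "poly_rel S q q'" "y = poly p x" "y' = poly p' x'"
    "z = poly q x" "z' = poly q' x'" unfolding adjoin_def by blast
  show "(y + z, y' + z') \<in> adjoin S x x'" unfolding adjoin_def
    using poly_rel_add[OF pq(1,2)] pq(3-6)
    by (intro CollectI exI[of _ "p + q"] exI[of _ "p' + q'"]) simp
  show "(y * z, y' * z') \<in> adjoin S x x'" unfolding adjoin_def
    using poly_rel_mult[OF pq(1,2)] pq(3-6)
    by (intro CollectI exI[of _ "p * q"] exI[of _ "p' * q'"]) simp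
next
  fix y assume "(0, y) \<in> adjoin S x x'"
  then show "y = 0" using adjoin_single_valued[OF assms] unfolding adjoin_def by force
qed

end

text \<open>An embedding over \<open>L\<close> of the whole algebraic closure. Algebraicity is part
  of the locale because surjectivity rests on it.\<close>

locale field_endo = closed_field_set L for L :: "'a :: field set" +
  fixes \<tau> :: "'a \<Rightarrow> 'a"
  assumes hom_add: "\<tau> (x + y) = \<tau> x + \<tau> y"
    and hom_mult: "\<tau> (x * y) = \<tau> x * \<tau> y"
    and fixes_base: "c \<in> L \<Longrightarrow> \<tau> c = c"
    and algebraic: "algebraic_over L x"

text \<open>A polynomial of least degree over the domain of \<open>S\<close> that annihilates
  \<open>x\<close> is made monic and carried over by \<open>S\<close>. Its image has a root
  \<open>x'\<close>, and adjoining the pair enlarges \<open>S\<close> unless \<open>x\<close> was in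
  the domain already.\<close>

lemma embedding_graph_total_if_maximal:
  fixes L :: "'a :: alg_closed_field set"
  assumes "embedding_graph L S"
    and max: "\<And>S'. embedding_graph L S' \<Longrightarrow> S \<subseteq> S' \<Longrightarrow> S' = S"
    and alg: "closed_field_set L" "\<And>x. algebraic_over L x"
  shows "\<exists>x'. (x, x') \<in> S"
proof -
  interpret closed_field_set L by fact
  interpret algebraic_embedding_graph L S by unfold_locales (use assms in auto)
  let ?P = "\<lambda>p. p \<noteq> 0 \<and> poly p x = 0 \<and> (\<exists>p'. poly_rel S p p')"
  obtain p0 where "p0 \<in> polys_over L" "p0 \<noteq> 0" "poly p0 x = 0"
    using alg(2)[of x] by (auto simp: algebraic_over_def)
  then have "?P p0" using poly_rel_refl by blast
  then obtain h where h: "?P h" and min: "\<And>q. ?P q \<Longrightarrow> Polynomial.degree h \<le> Polynomial.degree q"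
    using ex_has_least_nat[of ?P p0 Polynomial.degree] by blast
  then obtain h' where h': "poly_rel S h h'" by blast
  define n where "n = Polynomial.degree h"
  define c c' where "c = inverse (Polynomial.coeff h n)" and "c' = inverse (Polynomial.coeff h' n)"
  have c0: "Polynomial.coeff h n \<noteq> 0" using h by (simp add: n_def)
  have cc: "(c, c') \<in> S" unfolding c_def c'_def using h' by (intro pair_inverse) (simp add: poly_rel_def)
  define g g' where "g = Polynomial.smult c h" and "g' = Polynomial.smult c' h'"
  have rel: "poly_rel S g g'"
    using h' cc by (auto simp: g_def g'_def poly_rel_def intro: pair_mult)
  have c: "c \<noteq> 0" using c0 by (simp add: c_def)
  have deg: "Polynomial.degree g = n" using c by (simp add: g_def n_def)
  have lead: "Polynomial.coeff g n = 1" using c0 by (simp add: g_def c_def)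
  \<comment> \<open>The partner of the leading coefficient 1 is 1, so \<open>g'\<close> has positive
    degree and therefore a root.\<close>
  have "(Polynomial.coeff g n, Polynomial.coeff g' n) \<in> S" using rel by (simp add: poly_rel_def)
  then have "Polynomial.coeff g' n = 1" using pair_unique[OF _ pair_1] lead by auto
  moreover have "n > 0" using h poly_zero_imp_degree_pos unfolding n_def by blast
  ultimately have "Polynomial.degree g' > 0" using le_degree[of g' n] by simp
  then obtain x' where x': "poly g' x' = 0" using alg_closed_imp_poly_has_root by blast
  have "embedding_graph L (adjoin S x x')"
    by (rule embedding_graph_adjoin[OF rel]) (use deg lead h x' min in \<open>auto simp: g_def n_def\<close>)
  then have "adjoin S x x' = S" using max adjoin_incl by blast
  then show ?thesis using adjoin_mem by blast
qed

text \<open>Zorn's lemma gives a maximal graph above \<open>S0\<close>; it is total and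
  single-valued, hence the graph of a function.\<close>

lemma embedding_graph_extends:
  fixes L :: "'a :: alg_closed_field set"
  assumes S0: "embedding_graph L S0" and alg: "closed_field_set L" "\<And>x. algebraic_over L x"
  shows "\<exists>\<tau>. field_endo L \<tau> \<and> (\<forall>(x, x') \<in> S0. \<tau> x = x')"
proof -
  define A where "A = {S. embedding_graph L S \<and> S0 \<subseteq> S}"
  have "\<exists>M \<in> A. \<forall>S \<in> A. M \<subseteq> S \<longrightarrow> S = M"
  proof (rule subset_Zorn_nonempty)
    fix C assume C: "C \<noteq> {}" "subset.chain A C"
    then have sub: "C \<subseteq> A" by (simp add: subset.chain_def)
    have tot: "T \<subseteq> U \<or> U \<subseteq> T" if "T \<in> C" "U \<in> C" for T U
      using C that by (auto simp: subset.chain_def)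
    have "embedding_graph L (\<Union>C)"
      unfolding embedding_graph_def
    proof (intro conjI ballI allI impI)
      fix c assume "c \<in> L"
      then show "(c, c) \<in> \<Union>C" using C(1) sub by (fastforce simp: A_def embedding_graph_def)
    next
      fix x x' y y' assume "(x, x') \<in> \<Union>C" "(y, y') \<in> \<Union>C"
      then obtain T where T: "T \<in> C" "(x, x') \<in> T" "(y, y') \<in> T" using tot by blast
      then have "embedding_graph L T" using sub by (auto simp: A_def)
      then have "(x + y, x' + y') \<in> T" "(x * y, x' * y') \<in> T"
        using T by (simp_all add: embedding_graph_def)
      then show "(x + y, x' + y') \<in> \<Union>C" "(x * y, x' * y') \<in> \<Union>C" using T by auto
    next
      fix y assume "(0, y) \<in> \<Union>C"
      then show "y = 0" using sub by (auto simp: A_def embedding_graph_def)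
    qed
    then show "\<Union>C \<in> A" using C(1) sub unfolding A_def by auto
  qed (use S0 in \<open>auto simp: A_def\<close>)
  then obtain M where M: "embedding_graph L M" "S0 \<subseteq> M"
    and max: "\<And>S'. embedding_graph L S' \<Longrightarrow> M \<subseteq> S' \<Longrightarrow> S' = M" by (auto simp: A_def)
  interpret closed_field_set L by fact
  interpret algebraic_embedding_graph L M by unfold_locales (use M alg in auto)
  define \<tau> where "\<tau> x = (SOME x'. (x, x') \<in> M)" for x
  have "(x, \<tau> x) \<in> M" for x
    unfolding \<tau>_def using embedding_graph_total_if_maximal[OF M(1) max alg] by (rule someI_ex)
  then have eq: "\<tau> x = x'" if "(x, x') \<in> M" for x x' using that pair_unique by blast
  have mem: "(x, \<tau> x) \<in> M" for x by fact
  have "field_endo L \<tau>"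
    by unfold_locales (use eq mem alg in \<open>auto intro: pair_add pair_mult refl_mem\<close>)
  then show ?thesis using eq M(2) by blast
qed

text \<open>The identity graph of \<open>L\<close> extends by the pair \<open>(a, a')\<close>,
  because the minimal polynomial of \<open>a\<close> also annihilates \<open>a'\<close>.\<close>

lemma conjugation_exists:
  fixes L :: "'a :: alg_closed_field set"
  assumes alg: "closed_field_set L" "\<And>x. algebraic_over L x"
    and g: "is_min_poly L a g" and a': "poly g a' = 0"
  shows "\<exists>\<tau>. field_endo L \<tau> \<and> \<tau> a = a'"
proof -
  interpret closed_field_set L by fact
  have "embedding_graph L (Id_on L)"
    by (auto simp: embedding_graph_def intro: add_mem mult_mem)
  then interpret algebraic_embedding_graph L "Id_on L" by unfold_locales (use alg in auto)
  have rel: "poly_rel (Id_on L) p p' \<longleftrightarrow> p \<in> polys_over L \<and> p' = p" for p p'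
    by (auto simp: poly_rel_def polys_over_def poly_eq_iff Id_on_iff)
  have "embedding_graph L (adjoin (Id_on L) a a')"
    by (rule embedding_graph_adjoin[of g g]) (use g a' in \<open>auto simp: rel is_min_poly_def\<close>)
  from embedding_graph_extends[OF this alg] show ?thesis using adjoin_mem[of a a'] by fastforce
qed


section \<open>Transport of Gauss valuations along embeddings\<close>

context field_endo
begin

lemma hom_0 [simp]: "\<tau> 0 = 0" and hom_1 [simp]: "\<tau> 1 = 1"
  by (simp_all add: fixes_base)

lemma hom_uminus: "\<tau> (- x) = - \<tau> x"
  using hom_add[of x "- x"] by (simp add: eq_neg_iff_add_eq_0 add.commute)

lemma hom_diff: "\<tau> (x - y) = \<tau> x - \<tau> y"
  using hom_add[of x "- y"] by (simp add: hom_uminus)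

lemma hom_eq_0_iff [simp]: "\<tau> x = 0 \<longleftrightarrow> x = 0"
proof
  assume "\<tau> x = 0"
  then show "x = 0" using hom_mult[of x "inverse x"] by (cases "x = 0") auto
qed simp

lemma inj_hom: "inj \<tau>"
proof (rule injI)
  fix x y assume "\<tau> x = \<tau> y"
  then show "x = y" using hom_diff[of x y] by simp
qed

lemma hom_power: "\<tau> (x ^ n) = \<tau> x ^ n"
  by (induction n) (auto simp: hom_mult)

lemma hom_divide: "\<tau> (x / y) = \<tau> x / \<tau> y"
  using hom_mult[of "x / y" y] by (cases "y = 0") (auto simp: field_simps)

lemma hom_sum: "\<tau> (sum f A) = (\<Sum>i\<in>A. \<tau> (f i))"
  by (induction A rule: infinite_finite_induct) (auto simp: hom_add)

lemma hom_prod_mset: "\<tau> (\<Prod>x\<in>#A. f x) = (\<Prod>x\<in>#A. \<tau> (f x))"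
  by (induction A) (auto simp: hom_mult)

lemma map_poly_add: "map_poly \<tau> (p + q) = map_poly \<tau> p + map_poly \<tau> q"
  by (simp add: poly_eq_iff coeff_map_poly hom_add)

lemma map_poly_mult: "map_poly \<tau> (p * q) = map_poly \<tau> p * map_poly \<tau> q"
  by (simp add: poly_eq_iff coeff_map_poly coeff_mult hom_sum hom_mult)

lemma map_poly_base: "p \<in> polys_over L \<Longrightarrow> map_poly \<tau> p = p"
  by (simp add: poly_eq_iff coeff_map_poly polys_over_def fixes_base)

lemma map_poly_eq_iff: "map_poly \<tau> p = map_poly \<tau> q \<longleftrightarrow> p = q"
  using inj_hom by (auto simp: poly_eq_iff coeff_map_poly inj_eq)

lemma map_poly_eq_0_iff: "map_poly \<tau> p = 0 \<longleftrightarrow> p = 0"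
  by (auto simp: poly_eq_iff coeff_map_poly)

lemma poly_map_poly: "poly (map_poly \<tau> p) (\<tau> x) = \<tau> (poly p x)"
  by (induction p) (auto simp: map_poly_pCons hom_add hom_mult)

lemma poly_hom: "p \<in> polys_over L \<Longrightarrow> poly p (\<tau> x) = \<tau> (poly p x)"
  using poly_map_poly[of p x] map_poly_base[of p] by simp

text \<open>Each element is a root of a polynomial over \<open>L\<close>, and the injective
  \<open>\<tau>\<close> permutes the finite set of its roots.\<close>

lemma surj_hom: "surj \<tau>"
proof -
  have "\<exists>y. \<tau> y = x" for x
  proof -
    obtain p where p: "p \<in> polys_over L" "p \<noteq> 0" "poly p x = 0"
      using algebraic by (auto simp: algebraic_over_def)
    let ?R = "{y. poly p y = 0}"
    have "\<tau> ` ?R \<subseteq> ?R" using p by (auto simp: poly_hom)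
    then have "\<tau> ` ?R = ?R"
      by (intro endo_inj_surj poly_roots_finite p(2) inj_on_subset[OF inj_hom]) auto
    then have "x \<in> \<tau> ` ?R" using p by simp
    then show ?thesis by blast
  qed
  then show ?thesis by (metis surjI)
qed

lemma map_poly_surj: "\<exists>q. map_poly \<tau> q = p"
proof
  have "inv_into UNIV \<tau> 0 = 0" using inv_f_f[OF inj_hom, of 0] by simp
  then show "map_poly \<tau> (map_poly (inv_into UNIV \<tau>) p) = p"
    by (simp add: poly_eq_iff coeff_map_poly surj_f_inv_f[OF surj_hom])
qed

lemma map_poly_pcompose: "map_poly \<tau> (p \<circ>\<^sub>p q) = map_poly \<tau> p \<circ>\<^sub>p map_poly \<tau> q"
  by (induction p) (auto simp: pcompose_pCons map_poly_add map_poly_mult map_poly_pCons)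

lemma taylor_coeff_hom: "taylor_coeff (\<tau> a) (map_poly \<tau> f) i = \<tau> (taylor_coeff a f i)"
proof -
  have "map_poly \<tau> f \<circ>\<^sub>p [:\<tau> a, 1:] = map_poly \<tau> (f \<circ>\<^sub>p [:a, 1:])"
    by (simp add: map_poly_pcompose map_poly_pCons)
  then show ?thesis by (simp add: taylor_coeff_def coeff_map_poly)
qed

lemma gauss_val_poly_hom:
  fixes vb :: "'a \<Rightarrow> 'g :: linordered_ab_group_add"
  assumes "\<And>x. x \<noteq> 0 \<Longrightarrow> vb (\<tau> x) = vb x"
  shows "gauss_val_poly vb (\<tau> a) \<gamma> (map_poly \<tau> f) = gauss_val_poly vb a \<gamma> f"
  unfolding gauss_val_poly_def taylor_coeff_hom hom_eq_0_iff
  by (rule arg_cong[where f = Min]) (use assms in force)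

text \<open>\<open>gauss_val\<close> describes its value through all representations of
  \<open>r\<close> as a fraction over the closure. Applying \<open>\<tau>\<close> to numerator and
  denominator permutes these representations, so both descriptions are satisfied by the same
  \<open>d\<close>; uniqueness of \<open>d\<close> does not enter.\<close>

lemma gauss_val_conjugate:
  fixes vb :: "'a \<Rightarrow> 'g :: linordered_ab_group_add"
  assumes vb: "\<And>x. x \<noteq> 0 \<Longrightarrow> vb (\<tau> x) = vb x" and r: "r \<in> rat_funs L"
  shows "gauss_val vb (\<tau> a) \<gamma> r = gauss_val vb a \<gamma> r"
proof -
  obtain p q where pq: "p \<in> polys_over L" "q \<in> polys_over L" "q \<noteq> 0" "r = Fraction_Field.Fract p q"
    using r by (auto simp: rat_funs_def)
  \<comment> \<open>Compare with a representation \<open>p / q\<close> over \<open>L\<close>: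
    cross-multiplication leaves an equation in which \<open>p\<close> and \<open>q\<close> are fixed
    by \<open>\<tau>\<close>.\<close>
  have frac: "r = Fraction_Field.Fract (map_poly \<tau> f) (map_poly \<tau> g) \<longleftrightarrow> r = Fraction_Field.Fract f g"
    if "g \<noteq> 0" for f g
  proof -
    have "p * map_poly \<tau> g = map_poly \<tau> f * q \<longleftrightarrow> map_poly \<tau> (p * g) = map_poly \<tau> (f * q)"
      using pq by (simp add: map_poly_mult map_poly_base)
    then show ?thesis using pq that by (simp add: eq_fract map_poly_eq_0_iff map_poly_eq_iff)
  qed
  have "(\<exists>f g. f \<noteq> 0 \<and> g \<noteq> 0 \<and> r = Fraction_Field.Fract f g \<and>
           d = gauss_val_poly vb (\<tau> a) \<gamma> f - gauss_val_poly vb (\<tau> a) \<gamma> g) \<longleftrightarrow>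
        (\<exists>f g. f \<noteq> 0 \<and> g \<noteq> 0 \<and> r = Fraction_Field.Fract f g \<and>
           d = gauss_val_poly vb a \<gamma> f - gauss_val_poly vb a \<gamma> g)" (is "?l \<longleftrightarrow> ?r") for d
  proof
    assume ?l
    then obtain f g where "f \<noteq> 0" "g \<noteq> 0" "r = Fraction_Field.Fract f g"
      "d = gauss_val_poly vb (\<tau> a) \<gamma> f - gauss_val_poly vb (\<tau> a) \<gamma> g" by blast
    moreover obtain f' g' where "f = map_poly \<tau> f'" "g = map_poly \<tau> g'" using map_poly_surj by metis
    ultimately show ?r
      using frac gauss_val_poly_hom[of vb, OF vb] by (intro exI[of _ f'] exI[of _ g']) (auto simp: map_poly_eq_0_iff)
  next
    assume ?r
    then obtain f g where "f \<noteq> 0" "g \<noteq> 0" "r = Fraction_Field.Fract f g"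
      "d = gauss_val_poly vb a \<gamma> f - gauss_val_poly vb a \<gamma> g" by blast
    then show ?l
      using frac gauss_val_poly_hom[of vb, OF vb]
      by (intro exI[of _ "map_poly \<tau> f"] exI[of _ "map_poly \<tau> g"]) (auto simp: map_poly_eq_0_iff)
  qed
  then show ?thesis unfolding gauss_val_def by simp
qed

end

section \<open>Degrees of simple extensions\<close>

lemma nat_pow_type_ring: "x [^]\<^bsub>ring_of_type_algebra\<^esub> (n :: nat) = (x ^ n :: 'a :: field)"
proof -
  interpret R: field "ring_of_type_algebra :: 'a ring" by rule
  show ?thesis by (induction n) (auto simp: mult.commute)
qed

text \<open>HOL-Algebra polynomials are coefficient lists with the leading coefficient first, hence
  the reversal.\<close>

lemma poly_Poly_rev: "ring.eval ring_of_type_algebra xs x = poly (Poly (rev xs)) (x :: 'a :: field)"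
proof -
  interpret R: field "ring_of_type_algebra :: 'a ring" by rule
  show ?thesis
    by (induction xs) (auto simp: Poly_append poly_monom nat_pow_type_ring ac_simps)
qed

lemma (in closed_field_set) coeffs_in_univ_poly:
  "p \<in> polys_over K \<Longrightarrow> rev (coeffs p) \<in> carrier (univ_poly ring_of_type_algebra K)"
  by (auto simp: univ_poly_def polynomial_def hd_rev last_coeffs_eq_coeff_degree coeffs_def
      polys_over_def)

lemma (in closed_field_set) Poly_rev_polys_over:
  assumes "xs \<in> carrier (univ_poly ring_of_type_algebra K)"
  shows "Poly (rev xs) \<in> polys_over K" "Poly (rev xs) = 0 \<longleftrightarrow> xs = []"
proof -
  have sub: "xs = [] \<or> set xs \<subseteq> K \<and> hd xs \<noteq> 0"
    using assms by (auto simp: univ_poly_def polynomial_def)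
  then have "nth_default 0 (rev xs) i \<in> K" for i
    by (cases "i < length xs") (auto simp: nth_default_def rev_nth)
  then show "Poly (rev xs) \<in> polys_over K" by (simp add: polys_over_def)
  show "Poly (rev xs) = 0 \<longleftrightarrow> xs = []"
  proof
    assume z: "Poly (rev xs) = 0"
    show "xs = []"
    proof (rule ccontr)
      assume "xs \<noteq> []"
      then have "hd xs \<noteq> 0" using sub by auto
      moreover have "Polynomial.coeff (Poly (rev xs)) (length xs - 1) = hd xs"
        using \<open>xs \<noteq> []\<close> by (simp add: nth_default_def rev_nth hd_conv_nth)
      ultimately show False using z by simp
    qed
  qed simp
qed

lemma (in closed_field_set) algebraic_over_if_algebraic:
  assumes "(ring.algebraic ring_of_type_algebra over K) x"
  shows "algebraic_over K x"
proof -
  interpret R: field "ring_of_type_algebra :: 'a ring" by rule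
  have "subfield K ring_of_type_algebra" using closed_field_set_axioms by (simp add: subfield_type_ring_iff)
  from R.algebraicE[OF subfieldE(1)[OF this] _ assms] obtain xs where
    "xs \<in> carrier (univ_poly ring_of_type_algebra K)" "xs \<noteq> []" "R.eval xs x = 0" by auto
  then show ?thesis
    unfolding algebraic_over_def using Poly_rev_polys_over[of xs] poly_Poly_rev[of xs x] by auto
qed

text \<open>The dimension of the simple extension is the degree of \<open>Irr\<close>. This agrees
  with the degree of \<open>g\<close>, since \<open>Irr\<close> divides \<open>g\<close> and
  \<open>g\<close> has least degree.\<close>

lemma (in closed_field_set) degree_over_min_poly:
  assumes g: "is_min_poly K x g"
  shows "degree_over K x = Polynomial.degree g"
proof -
  interpret R: field "ring_of_type_algebra :: 'a ring" by rule
  have K: "subfield K ring_of_type_algebra" using closed_field_set_axioms by (simp add: subfield_type_ring_iff)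
  have x: "x \<in> carrier ring_of_type_algebra" by simp
  have g': "g \<in> polys_over K" "g \<noteq> 0" "poly g x = 0" using g by (auto simp: is_min_poly_def)
  let ?g = "rev (coeffs g)"
  have eg: "R.eval ?g x = 0" using g' by (simp add: poly_Poly_rev)
  have cg: "?g \<in> carrier (univ_poly ring_of_type_algebra K)" "?g \<noteq> []" using coeffs_in_univ_poly g' by auto
  have alg: "(R.algebraic over K) x"
    using R.algebraicI[of ?g K x] cg eg by (simp add: over_def)
  let ?I = "R.Irr K x"
  note I = R.IrrE[OF K x alg]
  have "?I pdivides\<^bsub>ring_of_type_algebra\<^esub> ?g" using R.Irr_minimal[OF K x alg cg(1)] eg by simp
  then have "length ?I - 1 \<le> length ?g - 1"
    using R.pdivides_imp_degree_le[OF subfieldE(1)[OF K] I(1) cg(1,2)] by simp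
  then have le: "length ?I - 1 \<le> Polynomial.degree g" using g' by (simp add: length_coeffs_degree)
  have "?I \<noteq> []" using I(3) I(2) unfolding ring_irreducible_def by (auto simp: univ_poly_def)
  then have "Polynomial.degree g \<le> Polynomial.degree (Poly (rev ?I))"
    using g Poly_rev_polys_over[OF I(1)] I(4) by (auto simp: is_min_poly_def poly_Poly_rev)
  also have "\<dots> \<le> length ?I - 1"
    by (rule degree_le) (auto simp: nth_default_def)
  finally have eq: "length ?I - 1 = Polynomial.degree g" using le by simp
  have sub: "subfield (R.simple_extension K x) ring_of_type_algebra"
    using R.simple_extension_is_subfield[OF K x] alg by simp
  \<comment> \<open>\<open>degree_over\<close> refers to the generated field, the dimension formula
    to the simple extension.\<close>
  have "R.simple_extension K x = generate_field ring_of_type_algebra (insert x K)"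
  proof (rule R.generate_fieldI)
    show "insert x K \<subseteq> R.simple_extension K x"
      using R.simple_extension_incl[of K x] R.simple_extension_mem[OF subfieldE(1)[OF K] x] by simp
    show "R.simple_extension K x \<subseteq> E" if "subfield E ring_of_type_algebra" "insert x K \<subseteq> E" for E
      using R.simple_extension_subring_incl[OF subfieldE(1)[OF that(1)]] that by simp
  qed (use sub in auto)
  then show ?thesis
    using R.dimI[OF K R.dimension_simple_extension[OF K x alg]] eq
    by (simp add: degree_over_def over_def)
qed

section \<open>Roots with multiplicity and norms\<close>

lemma proots_prod_linear: "proots (\<Prod>y\<in>#A. [:- y, 1:]) = (A :: 'a :: field multiset)"
proof (induction A)
  case (add y A)
  have "(\<Prod>y\<in>#A. [:- y, 1:]) \<noteq> 0" by (auto simp: prod_mset_zero_iff)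
  then show ?case using add
    by (simp only: image_mset_add_mset prod_mset.add_mset) (simp add: proots_mult del: mult_pCons_left)
qed simp

lemma split_proots:
  fixes p :: "'a :: alg_closed_field poly"
  assumes "p \<noteq> 0"
  shows "p = Polynomial.smult (Polynomial.lead_coeff p) (\<Prod>y\<in>#proots p. [:- y, 1:])"
proof -
  obtain A where A: "p = Polynomial.smult (Polynomial.lead_coeff p) (\<Prod>y\<in>#A. [:- y, 1:])"
    using alg_closed_imp_factorization[OF assms] by blast
  then have "proots p = A"
    using proots_prod_linear[of A] proots_smult[of "Polynomial.lead_coeff p"] assms
    by (metis leading_coeff_0_iff)
  then show ?thesis using A by simp
qed

lemma poly_prod_linear: "poly (\<Prod>y\<in>#A. [:- y, 1:]) x = (\<Prod>y\<in>#A. x - (y :: 'a :: field))"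
  by (induction A) (auto simp: algebra_simps)

lemma poly_split_proots:
  fixes p :: "'a :: alg_closed_field poly"
  assumes "p \<noteq> 0"
  shows "poly p x = Polynomial.lead_coeff p * (\<Prod>y\<in>#proots p. x - y)"
  by (subst split_proots[OF assms]) (simp only: poly_smult poly_prod_linear)

lemma prod_mset_swap:
  fixes f :: "'a \<Rightarrow> 'b \<Rightarrow> 'c :: comm_monoid_mult"
  shows "(\<Prod>x\<in>#A. \<Prod>y\<in>#B. f x y) = (\<Prod>y\<in>#B. \<Prod>x\<in>#A. f x y)"
  by (induction A) (auto simp: prod_mset.distrib)

lemma prod_mset_uminus: "(\<Prod>x\<in>#A. - f x) = (- 1) ^ size A * (\<Prod>x\<in>#A. f x :: 'a :: comm_ring_1)"
  by (induction A) (auto simp: algebra_simps)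

text \<open>
  The product is a resultant up to a constant factor, and it is computed by the Euclidean algorithm.
\<close>

lemma norm_mem:
  fixes g h :: "'a :: alg_closed_field poly"
  assumes K: "closed_field_set K" and "g \<in> polys_over K" "g \<noteq> 0" "h \<in> polys_over K"
  shows "(\<Prod>y\<in>#proots g. poly h y) \<in> K"
  using assms(2-)
proof (induction "Polynomial.degree g" arbitrary: g h rule: less_induct)
  case less
  interpret closed_field_set K by fact
  define g1 where "g1 = Polynomial.smult (inverse (Polynomial.lead_coeff g)) g"
  have g1: "g1 \<in> polys_over K" "Polynomial.lead_coeff g1 = 1" "proots g1 = proots g"
    "Polynomial.degree g1 = Polynomial.degree g"
    using less.prems unfolding g1_def by (auto intro!: polys_over_smult inverse_mem coeff_mem)
  then have "g1 \<noteq> 0" by auto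
  obtain q r where qr: "q \<in> polys_over K" "r \<in> polys_over K" "h = q * g1 + r"
    "r = 0 \<or> Polynomial.degree r < Polynomial.degree g1"
    using monic_division[OF g1(1,2) less.prems(3)] by blast
  \<comment> \<open>Reduction modulo \<open>g1\<close> does not affect values at the roots of
    \<open>g\<close>.\<close>
  have "poly h y = poly r y" if "y \<in># proots g" for y
    using that less.prems by (auto simp: qr(3) g1_def)
  then have h: "(\<Prod>y\<in>#proots g. poly h y) = (\<Prod>y\<in>#proots g. poly r y)"
    by (intro arg_cong[where f = prod_mset] image_mset_cong) auto
  show ?case
  proof (cases "r = 0")
    case True
    then show ?thesis unfolding h by (intro prod_mset_mem) auto
  next
    case False
    let ?s = "(- 1) ^ size (proots g)"
    have minus: "(\<Prod>y\<in>#proots g. y - t) = poly (Polynomial.smult ?s g1) t" for t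
      using prod_mset_uminus[of "\<lambda>y. t - y" "proots g"] poly_split_proots[OF \<open>g1 \<noteq> 0\<close>, of t] g1
      by simp
    \<comment> \<open>Reciprocity: up to sign and powers of the leading coefficient, the product of
      \<open>r\<close> over the roots of \<open>g\<close> is the product of \<open>g1\<close> over
      the roots of \<open>r\<close>, and \<open>r\<close> has smaller degree.\<close>
    have "(\<Prod>y\<in>#proots g. poly r y) =
      (\<Prod>y\<in>#proots g. Polynomial.lead_coeff r) * (\<Prod>y\<in>#proots g. \<Prod>t\<in>#proots r. y - t)"
      unfolding poly_split_proots[OF False] prod_mset.distrib by simp
    also have "(\<Prod>y\<in>#proots g. \<Prod>t\<in>#proots r. y - t) =
      (\<Prod>t\<in>#proots r. poly (Polynomial.smult ?s g1) t)"
      unfolding prod_mset_swap[of _ "proots r" "proots g"] minus ..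
    finally have eq: "(\<Prod>y\<in>#proots g. poly r y) = (\<Prod>y\<in>#proots g. Polynomial.lead_coeff r) *
      (\<Prod>t\<in>#proots r. poly (Polynomial.smult ?s g1) t)" .
    have "(\<Prod>t\<in>#proots r. poly (Polynomial.smult ?s g1) t) \<in> K"
      by (rule less.hyps) (use qr False g1 in \<open>auto intro!: polys_over_smult power_mem uminus_mem\<close>)
    then show ?thesis unfolding h eq by (intro mult_mem prod_mset_mem[of _ "\<lambda>_. Polynomial.lead_coeff r"] coeff_mem qr)
  qed
qed

lemma (in field_endo) map_poly_prod_linear:
  "map_poly \<tau> (\<Prod>y\<in>#A. [:- y, 1:]) = (\<Prod>y\<in>#image_mset \<tau> A. [:- y, 1:])"
proof (induction A)
  case (add y A)
  have "map_poly \<tau> [:- y, 1:] = [:- \<tau> y, 1:]" by (simp add: map_poly_pCons hom_uminus)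
  then show ?case using add by (simp only: image_mset_add_mset prod_mset.add_mset map_poly_mult)
qed (simp add: map_poly_base)

text \<open>\<open>\<tau>\<close> fixes \<open>g\<close>, and the multiset of roots can be read off
  the factorization. Multiplicities are kept, so inseparable polynomials are covered.\<close>

lemma image_proots:
  fixes g :: "'a :: alg_closed_field poly"
  assumes \<tau>: "field_endo K \<tau>" and g: "g \<in> polys_over K" "Polynomial.lead_coeff g = 1"
  shows "image_mset \<tau> (proots g) = proots g"
proof -
  interpret field_endo K \<tau> by fact
  have g': "g = (\<Prod>y\<in>#proots g. [:- y, 1:])" using split_proots[of g] g(2) by (metis leading_coeff_0_iff smult_1_left zero_neq_one)
  have "(\<Prod>y\<in>#image_mset \<tau> (proots g). [:- y, 1:]) = map_poly \<tau> (\<Prod>y\<in>#proots g. [:- y, 1:])"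
    by (rule map_poly_prod_linear[symmetric])
  also have "\<dots> = g" using g' map_poly_base[OF g(1)] by simp
  finally show ?thesis using proots_prod_linear[of "image_mset \<tau> (proots g)"] by simp
qed

subsection \<open>Valuations on the algebraic closure\<close>

locale full_valuation =
  fixes vb :: "'a :: field \<Rightarrow> 'g :: linordered_ab_group_add"
  assumes val_mult: "x \<noteq> 0 \<Longrightarrow> y \<noteq> 0 \<Longrightarrow> vb (x * y) = vb x + vb y"
    and val_add: "x \<noteq> 0 \<Longrightarrow> y \<noteq> 0 \<Longrightarrow> x + y \<noteq> 0 \<Longrightarrow> min (vb x) (vb y) \<le> vb (x + y)"
begin

definition small :: "'g \<Rightarrow> 'a \<Rightarrow> bool" where
  "small \<delta> x \<longleftrightarrow> x = 0 \<or> \<delta> < vb x"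

lemma val_1 [simp]: "vb 1 = 0"
  using val_mult[of 1 1] by simp

lemma val_uminus [simp]: "vb (- x) = vb x"
proof (cases "x = 0")
  case False
  have "vb (- 1) + vb (- 1) = 0" using val_mult[of "- 1" "- 1"] by simp
  then have "vb (- 1) = 0" by simp
  then show ?thesis using val_mult[of "- 1" x] False by simp
qed simp

lemma val_inverse: "x \<noteq> 0 \<Longrightarrow> vb (inverse x) = - vb x"
  using val_mult[of x "inverse x"] by (simp add: eq_neg_iff_add_eq_0 add.commute)

lemma val_divide: "x \<noteq> 0 \<Longrightarrow> y \<noteq> 0 \<Longrightarrow> vb (x / y) = vb x - vb y"
  by (simp add: divide_inverse val_mult val_inverse)

lemma val_power_Suc: "x \<noteq> 0 \<Longrightarrow> vb (x ^ Suc n) = vb x + vb (x ^ n)"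
  by (simp add: val_mult)

lemma val_power_mono: "x \<noteq> 0 \<Longrightarrow> y \<noteq> 0 \<Longrightarrow> vb x \<le> vb y \<Longrightarrow> vb (x ^ n) \<le> vb (y ^ n)"
  by (induction n) (auto simp: val_mult intro: add_mono)

lemma val_power_strict_mono:
  assumes "x \<noteq> 0" "y \<noteq> 0" "vb x < vb y" "n > 0" shows "vb (x ^ n) < vb (y ^ n)"
proof -
  obtain m where m: "n = Suc m" using \<open>n > 0\<close> gr0_implies_Suc by blast
  show ?thesis unfolding m val_power_Suc[OF assms(1)] val_power_Suc[OF assms(2)]
    using assms val_power_mono[of x y m] by (intro add_less_le_mono) auto
qed

lemma val_power_pos: "x \<noteq> 0 \<Longrightarrow> 0 < vb x \<Longrightarrow> n > 0 \<Longrightarrow> 0 < vb (x ^ n)"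
  using val_power_strict_mono[of 1 x n] by simp

lemma val_power_nonneg: "x \<noteq> 0 \<Longrightarrow> 0 \<le> vb x \<Longrightarrow> 0 \<le> vb (x ^ n)"
  using val_power_mono[of 1 x n] by simp

lemma val_power_eq_cong: "x \<noteq> 0 \<Longrightarrow> y \<noteq> 0 \<Longrightarrow> vb x = vb y \<Longrightarrow> vb (x ^ n) = vb (y ^ n)"
  by (induction n) (auto simp: val_mult)

lemma small_0 [simp]: "small \<delta> 0"
  by (simp add: small_def)

lemma small_add: "small \<delta> x \<Longrightarrow> small \<delta> y \<Longrightarrow> small \<delta> (x + y)"
  using val_add[of x y] unfolding small_def
  by (metis add.left_neutral add.right_neutral less_le_trans min_less_iff_conj)

lemma small_uminus: "small \<delta> (- x) \<longleftrightarrow> small \<delta> x"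
  by (simp add: small_def)

lemma small_diff: "small \<delta> x \<Longrightarrow> small \<delta> y \<Longrightarrow> small \<delta> (x - y)"
  using small_add[of \<delta> x "- y"] by (simp add: small_uminus)

lemma small_sum: "(\<And>i. i \<in> A \<Longrightarrow> small \<delta> (f i)) \<Longrightarrow> small \<delta> (sum f A)"
  by (induction A rule: infinite_finite_induct) (auto intro: small_add)

lemma small_mult_left: "x \<noteq> 0 \<Longrightarrow> small (\<delta> + vb x) (x * y) \<longleftrightarrow> small \<delta> y"
  by (cases "y = 0") (auto simp: small_def val_mult add.commute)

lemma small_mono: "small \<delta> x \<Longrightarrow> \<epsilon> \<le> \<delta> \<Longrightarrow> small \<epsilon> x"
  by (auto simp: small_def)

lemma val_add_small:
  assumes "x \<noteq> 0" "small (vb x) y" shows "x + y \<noteq> 0" "vb (x + y) = vb x"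
proof -
  show nz: "x + y \<noteq> 0"
  proof
    assume "x + y = 0"
    then have "y = - x" by (simp add: eq_neg_iff_add_eq_0 add.commute)
    then show False using assms by (simp add: small_def)
  qed
  show "vb (x + y) = vb x"
  proof (cases "y = 0")
    case False
    then have less: "vb x < vb y" using assms by (simp add: small_def)
    have "vb x \<le> vb (x + y)" using val_add[OF assms(1) False nz] less by simp
    moreover have "min (vb (x + y)) (vb (- y)) \<le> vb (x + y + - y)"
      using val_add[of "x + y" "- y"] nz False assms by simp
    then have "vb (x + y) \<le> vb x" using less by (auto simp: min_le_iff_disj)
    ultimately show ?thesis by simp
  qed simp
qed

text \<open>The term of least value strictly dominates the sum of the others.\<close>

lemma sum_nonzero_if_distinct_values:
  assumes "finite A" "A \<noteq> {}" "\<And>i. i \<in> A \<Longrightarrow> t i \<noteq> 0" "inj_on (\<lambda>i. vb (t i)) A"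
  shows "sum t A \<noteq> 0"
proof -
  obtain k where k: "k \<in> A" and min: "\<And>i. i \<in> A \<Longrightarrow> vb (t k) \<le> vb (t i)"
    using arg_min_if_finite[of A "\<lambda>i. vb (t i)"] assms(1,2) by (metis not_le)
  have "small (vb (t k)) (sum t (A - {k}))"
  proof (rule small_sum)
    fix i assume "i \<in> A - {k}"
    then have "vb (t k) \<noteq> vb (t i)" using assms(4) k by (auto simp: inj_on_def)
    then show "small (vb (t k)) (t i)" using min[of i] \<open>i \<in> A - {k}\<close> by (auto simp: small_def)
  qed
  from val_add_small(1)[OF assms(3)[OF k] this] show ?thesis
    using sum.remove[OF assms(1) k, of t] by simp
qed

text \<open>In a relation \<open>p(x) = 0\<close> two nonzero terms must have equal value; comparing
  them puts a multiple of \<open>vb x\<close> into the value group of \<open>K\<close>.\<close>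

lemma value_torsion:
  assumes K: "closed_field_set K" and alg: "algebraic_over K x" and x: "x \<noteq> 0"
  obtains n d where "n > 0" "d \<in> K" "d \<noteq> 0" "vb (x ^ n) = vb d"
proof -
  interpret closed_field_set K by fact
  obtain p where p: "p \<in> polys_over K" "p \<noteq> 0" "poly p x = 0"
    using alg by (auto simp: algebraic_over_def)
  define I where "I = {i. i \<le> Polynomial.degree p \<and> Polynomial.coeff p i \<noteq> 0}"
  define t where "t i = Polynomial.coeff p i * x ^ i" for i
  have "sum t I = (\<Sum>i\<le>Polynomial.degree p. t i)"
    by (rule sum.mono_neutral_left) (auto simp: I_def t_def)
  then have "sum t I = 0" using p by (simp add: poly_altdef t_def)
  moreover have "finite I" "I \<noteq> {}" "\<And>i. i \<in> I \<Longrightarrow> t i \<noteq> 0"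
    using p x by (auto simp: I_def t_def intro!: exI[of _ "Polynomial.degree p"])
  ultimately have "\<not> inj_on (\<lambda>i. vb (t i)) I"
    using sum_nonzero_if_distinct_values by blast
  then obtain i j where ij: "i \<in> I" "j \<in> I" "i < j" "vb (t i) = vb (t j)"
    unfolding inj_on_def by (metis nat_neq_iff)
  let ?c = "Polynomial.coeff p"
  have nz: "?c i \<noteq> 0" "?c j \<noteq> 0" using ij by (auto simp: I_def)
  have "x ^ j = x ^ i * x ^ (j - i)" using ij by (simp flip: power_add)
  then have "vb (x ^ (j - i)) = vb (?c i) - vb (?c j)"
    using ij(4) nz x by (simp add: t_def val_mult algebra_simps)
  also have "\<dots> = vb (?c i / ?c j)" using nz by (simp add: val_divide)
  finally show ?thesis
    using ij nz p by (intro that[of "j - i" "?c i / ?c j"]) (auto intro: divide_mem coeff_mem)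
qed


text \<open>If all factors had value below \<open>vb c\<close>, their product would have value at
  most that of \<open>c ^ size A\<close>.\<close>

lemma distance_of_root:
  assumes small: "small (vb (c ^ size A)) (\<Prod>y\<in>#A. a - y)" and "c \<noteq> 0" "A \<noteq> {#}"
  shows "\<exists>y. y \<in># A \<and> (a - y = 0 \<or> vb c \<le> vb (a - y))"
proof (rule ccontr)
  assume "\<not> ?thesis"
  then have *: "a - y \<noteq> 0 \<and> vb (a - y) < vb c" if "y \<in># A" for y using that by (metis not_le)
  have "(\<Prod>y\<in>#B. a - y) \<noteq> 0 \<and> vb (\<Prod>y\<in>#B. a - y) \<le> vb (c ^ size B)" if "B \<subseteq># A" for B
    using that
  proof (induction B)
    case (add y B)
    then have "y \<in># A" "B \<subseteq># A" by (auto dest: mset_subset_eqD insert_subset_eq_iff[THEN iffD1] mset_subset_eq_insertD)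
    then show ?case using add.IH *[of y] \<open>c \<noteq> 0\<close> by (auto simp: val_mult intro: add_mono)
  qed simp
  then show False using small unfolding small_def by fastforce
qed

section \<open>Density and the topological closure of a subfield\<close>

definition dense_sub :: "'a set \<Rightarrow> 'a set \<Rightarrow> bool" where
  "dense_sub K L \<longleftrightarrow> (\<forall>x \<in> L. \<forall>c. c \<noteq> 0 \<longrightarrow> (\<exists>k \<in> K. small (vb c) (k - x)))"

definition closure_of_sub :: "'a set \<Rightarrow> 'a set" where
  "closure_of_sub K = {x. \<forall>c. c \<noteq> 0 \<longrightarrow> (\<exists>k \<in> K. small (vb c) (k - x))}"

lemma closure_of_subD: "x \<in> closure_of_sub K \<Longrightarrow> c \<noteq> 0 \<Longrightarrow> \<exists>k \<in> K. small (vb c) (k - x)"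
  by (simp add: closure_of_sub_def)

lemma closure_of_sub_incl: "K \<subseteq> closure_of_sub K"
proof
  fix x assume "x \<in> K"
  then show "x \<in> closure_of_sub K"
    unfolding closure_of_sub_def by (auto intro!: bexI[of _ x])
qed

lemma dense_closure_of_sub: "dense_sub K (closure_of_sub K)"
  by (simp add: dense_sub_def closure_of_sub_def)

text \<open>Continuity of the field operations in the valuation topology.\<close>

lemma closed_field_set_closure:
  assumes "closed_field_set K" shows "closed_field_set (closure_of_sub K)"
proof -
  interpret closed_field_set K by fact
  let ?L = "closure_of_sub K"
  have add: "x + y \<in> ?L" if "x \<in> ?L" "y \<in> ?L" for x y
    unfolding closure_of_sub_def
  proof (intro CollectI allI impI)
    fix c :: 'a assume "c \<noteq> 0"
    then obtain k where k: "k \<in> K" "small (vb c) (k - x)" using closure_of_subD \<open>x \<in> ?L\<close> by blast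
    obtain l where l: "l \<in> K" "small (vb c) (l - y)" using closure_of_subD \<open>y \<in> ?L\<close> \<open>c \<noteq> 0\<close> by blast
    have "small (vb c) (k + l - (x + y))" using small_add[OF k(2) l(2)] by (simp add: algebra_simps)
    then show "\<exists>k\<in>K. small (vb c) (k - (x + y))" using k l add_mem by blast
  qed
  have mult: "x * y \<in> ?L" if "x \<in> ?L" "y \<in> ?L" for x y
    unfolding closure_of_sub_def
  proof (intro CollectI allI impI)
    fix c :: 'a assume "c \<noteq> 0"
    have approx: "\<exists>k\<in>K. small (vb c) (u * (k - z))" if "z \<in> ?L" for u z
    proof (cases "u = 0")
      case False
      obtain k where "k \<in> K" "small (vb (c / u)) (k - z)"
        using closure_of_subD[OF \<open>z \<in> ?L\<close>, of "c / u"] False \<open>c \<noteq> 0\<close> by auto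
      then show ?thesis using small_mult_left[OF False, of "vb (c / u)" "k - z"] False \<open>c \<noteq> 0\<close>
        by (auto simp: val_divide)
    qed (auto intro: zero_mem)
    \<comment> \<open>First \<open>l\<close> is chosen for the fixed factor \<open>x\<close>, then
      \<open>k\<close> for the fixed factor \<open>l\<close>; the error is
      \<open>x (l - y) + l (k - x)\<close>.\<close>
    obtain l where l: "l \<in> K" "small (vb c) (x * (l - y))" using approx \<open>y \<in> ?L\<close> by blast
    obtain k where k: "k \<in> K" "small (vb c) (l * (k - x))" using approx \<open>x \<in> ?L\<close> by blast
    have "small (vb c) (k * l - x * y)" using small_add[OF l(2) k(2)] by (simp add: algebra_simps)
    then show "\<exists>k\<in>K. small (vb c) (k - x * y)" using k l mult_mem by blast
  qed
  have inverse: "inverse x \<in> ?L" if "x \<in> ?L" for x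
  proof (cases "x = 0")
    case True
    then show ?thesis using closure_of_sub_incl[of K] zero_mem by auto
  next
    case False
    show ?thesis unfolding closure_of_sub_def
    proof (intro CollectI allI impI)
      fix c :: 'a assume "c \<noteq> 0"
      \<comment> \<open>The larger of two radii: \<open>vb x\<close> ensures that \<open>k\<close>
        is nonzero with the value of \<open>x\<close>, and \<open>vb (c * x * x)\<close> brings the
        inverses within \<open>vb c\<close>.\<close>
      define e where "e = (if vb x \<le> vb (c * x * x) then c * x * x else x)"
      have e: "e \<noteq> 0" "vb x \<le> vb e" "vb (c * x * x) \<le> vb e"
        using False \<open>c \<noteq> 0\<close> by (auto simp: e_def)
      obtain k where k: "k \<in> K" "small (vb e) (k - x)" using closure_of_subD[OF \<open>x \<in> ?L\<close> e(1)] by blast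
      have "small (vb x) (k - x)" using small_mono[OF k(2) e(2)] .
      from val_add_small[OF False this] have kx: "k \<noteq> 0" "vb k = vb x" by auto
      have eq: "k - x = (- k * x) * (inverse k - inverse x)" using kx False by (simp add: field_simps)
      have "vb (c * x * x) = vb c + vb (- k * x)"
        using kx False \<open>c \<noteq> 0\<close> by (simp add: val_mult add.assoc)
      then have "small (vb c + vb (- k * x)) ((- k * x) * (inverse k - inverse x))"
        using small_mono[OF k(2) e(3)] eq by simp
      then have "small (vb c) (inverse k - inverse x)"
        using small_mult_left[of "- k * x" "vb c"] kx False by simp
      then show "\<exists>k\<in>K. small (vb c) (k - inverse x)" using k inverse_mem by blast
    qed
  qed
  have K: "0 \<in> ?L" "1 \<in> ?L" "- 1 \<in> ?L"
    using closure_of_sub_incl[of K] zero_mem one_mem uminus_mem by blast+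
  have "- x \<in> ?L" if "x \<in> ?L" for x using mult[OF K(3) that] by simp
  then show ?thesis by unfold_locales (use K add mult inverse in auto)
qed

end

subsection \<open>Continuity of roots\<close>

text \<open>If the coefficients of \<open>g'\<close> are close to those of \<open>g\<close>, then
  \<open>g'(a) = g'(a) - g(a)\<close> is small. Being the product of the differences between
  \<open>a\<close> and the roots of \<open>g'\<close>, it forces some root to lie close to
  \<open>a\<close>.\<close>

lemma approximate_root:
  fixes vb :: "'a :: alg_closed_field \<Rightarrow> 'g :: linordered_ab_group_add"
  assumes vb: "full_valuation vb" and K: "closed_field_set K"
    and dense: "full_valuation.dense_sub vb K L"
    and g: "g \<in> polys_over L" "Polynomial.lead_coeff g = 1" "poly g a = 0" and "c \<noteq> 0"
  obtains g' b where "g' \<in> polys_over K" "Polynomial.lead_coeff g' = 1"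
    "Polynomial.degree g' = Polynomial.degree g" "poly g' b = 0" "a - b = 0 \<or> vb c \<le> vb (a - b)"
proof -
  interpret full_valuation vb by fact
  interpret closed_field_set K by fact
  define n where "n = Polynomial.degree g"
  have n: "n > 0" using poly_zero_imp_degree_pos[of g a] g(2,3) unfolding n_def by (metis leading_coeff_0_iff zero_neq_one)
  have gn: "Polynomial.coeff g n = 1" using g by (simp add: n_def)
  \<comment> \<open>A nonzero substitute for \<open>a\<close>, by whose powers the radii are
    divided. For \<open>a = 0\<close> only the term with exponent 0 survives, and there the powers
    agree.\<close>
  define s where "s = (if a = 0 then 1 else a)"
  have s: "s \<noteq> 0" by (simp add: s_def)
  have "\<exists>k\<in>K. small (vb (c ^ n / s ^ i)) (k - Polynomial.coeff g i)" for i
    using dense g(1) \<open>c \<noteq> 0\<close> s by (auto simp: dense_sub_def polys_over_def)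
  then obtain k where k: "k i \<in> K" "small (vb (c ^ n / s ^ i)) (k i - Polynomial.coeff g i)" for i
    by metis
  define g' where "g' = Polynomial.monom 1 n + (\<Sum>i<n. Polynomial.monom (k i) i)"
  have cg': "Polynomial.coeff g' i = (if i < n then k i else if i = n then 1 else 0)" for i
    by (auto simp: g'_def coeff_sum)
  have deg: "Polynomial.degree g' = n"
    using n by (intro antisym degree_le le_degree) (auto simp: cg')
  have K': "g' \<in> polys_over K" using k by (auto simp: polys_over_def cg')
  have lead: "Polynomial.lead_coeff g' = 1" by (simp add: deg cg')
  have "g' \<noteq> 0" using lead by auto
  have "poly g' a = poly g' a - poly g a" using g by simp
  also have "\<dots> = (\<Sum>i\<le>n. (Polynomial.coeff g' i - Polynomial.coeff g i) * a ^ i)"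
    using deg by (simp add: poly_altdef n_def sum_subtractf algebra_simps)
  finally have eq: "poly g' a = (\<Sum>i\<le>n. (Polynomial.coeff g' i - Polynomial.coeff g i) * a ^ i)" .
  have "small (vb (c ^ n)) (poly g' a)"
    unfolding eq
  proof (rule small_sum)
    fix i assume "i \<in> {..n}"
    consider "i = n" | "i < n" "a ^ i = 0" | "i < n" "a ^ i = s ^ i" "s ^ i \<noteq> 0"
      using \<open>i \<in> {..n}\<close> s by (cases "a = 0"; cases i) (force simp: s_def)+
    then show "small (vb (c ^ n)) ((Polynomial.coeff g' i - Polynomial.coeff g i) * a ^ i)"
    proof cases
      case 3
      then show ?thesis
        using k(2)[of i] small_mult_left[of "s ^ i" "vb (c ^ n / s ^ i)" "k i - Polynomial.coeff g i"] \<open>c \<noteq> 0\<close> s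
        by (simp add: cg' val_divide mult.commute)
    qed (auto simp: cg' gn power_0_left)
  qed
  moreover have prod: "poly g' a = (\<Prod>y\<in>#proots g'. a - y)"
    using poly_split_proots[OF \<open>g' \<noteq> 0\<close>, of a] lead by simp
  moreover have "size (proots g') = n"
  proof -
    have "Polynomial.degree (\<Prod>y\<in>#A. [:- y, 1:]) = size A" for A :: "'a multiset"
    proof (induction A)
      case (add y A)
      have "(\<Prod>y\<in>#A. [:- y, 1:]) \<noteq> 0" by (auto simp: prod_mset_zero_iff)
      then show ?case using add
        by (simp only: image_mset_add_mset prod_mset.add_mset) (simp add: degree_mult_eq del: mult_pCons_left)
    qed simp
    then show ?thesis using split_proots[OF \<open>g' \<noteq> 0\<close>] lead deg by (metis smult_1_left)
  qed
  moreover from this n have "proots g' \<noteq> {#}" by (metis less_irrefl size_empty)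
  ultimately obtain b where "b \<in># proots g'" "a - b = 0 \<or> vb c \<le> vb (a - b)"
    using distance_of_root[of c "proots g'" a] \<open>c \<noteq> 0\<close> by metis
  then show ?thesis using that[of g' b] K' lead deg \<open>g' \<noteq> 0\<close> by (simp add: n_def)
qed

text \<open>
  By continuity of roots and minimality, the minimal polynomial of \<open>a\<close> over \<open>K\<close> stays irreducible
  over \<open>L\<close>, so the conjugates of \<open>a\<close> over \<open>K\<close> are conjugates over \<open>L\<close>.
\<close>

lemma conjugates_of_minimal_pair:
  fixes vb :: "'a :: alg_closed_field \<Rightarrow> 'g :: linordered_ab_group_add"
  assumes vb: "full_valuation vb" and K: "closed_field_set K" and L: "closed_field_set L" "K \<subseteq> L"
    and alg: "\<And>x. algebraic_over K x"
    and inv: "\<And>\<tau> x. field_endo L \<tau> \<Longrightarrow> x \<noteq> 0 \<Longrightarrow> vb (\<tau> x) = vb x"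
    and dense: "L = K \<or> full_valuation.dense_sub vb K L \<and> (\<exists>c. c \<noteq> 0 \<and> \<gamma> \<le> vb c)"
    and minimal: "minimal_pair_of_definition K vb w a \<gamma>" and a': "conjugate_over K a a'"
  shows "pair_of_definition K vb w a' \<gamma>"
proof -
  interpret K: closed_field_set K by fact
  interpret L: closed_field_set L by fact
  obtain f where f: "is_min_poly K a f" using K.min_poly_exists alg by blast
  obtain g where g: "is_min_poly L a g" using L.min_poly_exists algebraic_over_mono[OF L(2) alg] by blast
  have fL: "f \<in> polys_over L" "poly f a = 0" "Polynomial.lead_coeff f = 1"
    using f polys_over_mono[OF L(2)] by (auto simp: is_min_poly_def)
  have gL: "g \<in> polys_over L" "poly g a = 0" "Polynomial.lead_coeff g = 1"
    using g by (auto simp: is_min_poly_def)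
  have "Polynomial.degree f \<le> Polynomial.degree g"
    using dense
  proof
    assume "L = K"
    then show ?thesis using f gL by (auto simp: is_min_poly_def)
  next
    assume "full_valuation.dense_sub vb K L \<and> (\<exists>c. c \<noteq> 0 \<and> \<gamma> \<le> vb c)"
    then obtain c where c: "full_valuation.dense_sub vb K L" "c \<noteq> 0" "\<gamma> \<le> vb c" by blast
    \<comment> \<open>As \<open>\<gamma> \<le> vb c\<close>, the root \<open>b\<close> is close
      enough to \<open>a\<close> for the minimality of the pair to apply.\<close>
    from approximate_root[OF vb K c(1) gL(1,3,2) c(2)] obtain g' b where
      g': "g' \<in> polys_over K" "Polynomial.lead_coeff g' = 1" "Polynomial.degree g' = Polynomial.degree g"
        "poly g' b = 0" and b: "a - b = 0 \<or> vb c \<le> vb (a - b)" by blast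
    obtain h where h: "is_min_poly K b h" using K.min_poly_exists alg by blast
    have "Polynomial.degree f = degree_over K a" using K.degree_over_min_poly[OF f] by simp
    also have "\<dots> \<le> degree_over K b"
      using minimal b c(3) unfolding minimal_pair_of_definition_def by fastforce
    also have "\<dots> = Polynomial.degree h" by (rule K.degree_over_min_poly[OF h])
    also have "\<dots> \<le> Polynomial.degree g'" using h g' by (auto simp: is_min_poly_def)
    finally show ?thesis using g' by simp
  qed
  moreover have "Polynomial.degree g \<le> Polynomial.degree f"
    using g fL by (auto simp: is_min_poly_def)
  \<comment> \<open>Otherwise \<open>f - g\<close> would vanish at \<open>a\<close> with a degree
    below that of \<open>g\<close>.\<close>
  ultimately have "f = g"
    using degree_diff_lead_less[of g f] L.min_poly_dvd[OF g L.polys_over_diff[OF fL(1) gL(1)]] g fL gL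
      L.polys_over_diff[OF fL(1) gL(1)] unfolding is_min_poly_def by force
  then have "poly g a' = 0" using a' f by (auto simp: conjugate_over_def is_min_poly_def)
  then obtain \<tau> where \<tau>: "field_endo L \<tau>" "\<tau> a = a'"
    using conjugation_exists[OF L(1) algebraic_over_mono[OF L(2) alg] g] by blast
  interpret field_endo L \<tau> by fact
  have "rat_funs K \<subseteq> rat_funs L" using polys_over_mono[OF L(2)] by (auto simp: rat_funs_def)
  then have "gauss_val vb a' \<gamma> r = gauss_val vb a \<gamma> r" if "r \<in> rat_funs K" for r
    using gauss_val_conjugate[of vb r a \<gamma>] inv[OF \<tau>(1)] \<tau>(2) that by blast
  then show ?thesis
    using minimal by (auto simp: minimal_pair_of_definition_def pair_of_definition_def agree_on_def)
qed

subsection \<open>Rank one\<close>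

context full_valuation
begin

text \<open>In rank one, zero is the only proper convex subgroup, so the convex subgroup generated
  by \<open>vb d > 0\<close> is the whole value group.\<close>

lemma archimedean_if_rank_one:
  assumes K: "closed_field_set K" and rank: "rank_one K vb"
    and d: "d \<in> K" "d \<noteq> 0" "0 < vb d" and e: "e \<in> K" "e \<noteq> 0"
  shows "\<exists>m. vb e < vb (d ^ m)"
proof -
  interpret closed_field_set K by fact
  let ?G = "value_group K vb"
  have carrier: "carrier ?G = vb ` (K - {0})" by (simp add: value_group_def)
  have ops: "x \<otimes>\<^bsub>?G\<^esub> y = x + y" "\<one>\<^bsub>?G\<^esub> = 0" for x y by (simp_all add: value_group_def)
  have mem: "vb x \<in> carrier ?G" if "x \<in> K" "x \<noteq> 0" for x using that by (simp add: carrier)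
  have uminus: "- x \<in> carrier ?G" if x: "x \<in> carrier ?G" for x
  proof -
    obtain y where "y \<in> K" "y \<noteq> 0" "x = vb y" using x by (auto simp: carrier)
    then show ?thesis using mem[of "inverse y"] inverse_mem by (simp add: val_inverse)
  qed
  have plus: "x + y \<in> carrier ?G" if xy: "x \<in> carrier ?G" "y \<in> carrier ?G" for x y
  proof -
    obtain s t where "s \<in> K" "s \<noteq> 0" "x = vb s" "t \<in> K" "t \<noteq> 0" "y = vb t" using xy by (auto simp: carrier)
    then show ?thesis using mem[of "s * t"] mult_mem by (simp add: val_mult)
  qed
  have zero: "0 \<in> carrier ?G" using mem[OF one_mem] by simp
  interpret G: group ?G
    by (rule groupI) (use uminus plus zero in \<open>auto simp: ops add.assoc intro!: bexI[of _ "- _"]\<close>)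
  have inv: "m_inv ?G x = - x" if "x \<in> carrier ?G" for x
    using G.inv_equality[of "- x" x] that uminus by (simp add: ops)
  \<comment> \<open>The convex subgroup generated by \<open>vb d\<close>; \<open>vb (d ^ m)\<close>
    serves as the \<open>m\<close>-fold multiple.\<close>
  define H where "H = {x \<in> carrier ?G. \<exists>m. - vb (d ^ m) \<le> x \<and> x \<le> vb (d ^ m)}"
  have mono: "vb (d ^ m) \<le> vb (d ^ (m + n))" for m n
    using val_power_nonneg[of d n] d by (simp add: power_add val_mult)
  have "convex_subgroup H ?G"
    unfolding convex_subgroup_def
  proof (intro conjI ballI impI)
    show "subgroup H ?G"
    proof (rule G.subgroupI)
      show "H \<noteq> {}" using zero unfolding H_def by (auto intro!: exI[of _ 0])
      fix x assume "x \<in> H"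
      then show "m_inv ?G x \<in> H"
        using uminus inv unfolding H_def by (auto simp: minus_le_iff le_minus_iff)
      fix y assume "y \<in> H"
      obtain m n where "- vb (d ^ m) \<le> x" "x \<le> vb (d ^ m)" "- vb (d ^ n) \<le> y" "y \<le> vb (d ^ n)"
        using \<open>x \<in> H\<close> \<open>y \<in> H\<close> unfolding H_def by blast
      then have "- vb (d ^ (m + n)) \<le> x + y \<and> x + y \<le> vb (d ^ (m + n))"
        using d add_mono[of "- vb (d ^ m)" x "- vb (d ^ n)" y] add_mono[of x "vb (d ^ m)" y "vb (d ^ n)"]
        by (simp add: power_add val_mult)
      then show "x \<otimes>\<^bsub>?G\<^esub> y \<in> H"
        using plus \<open>x \<in> H\<close> \<open>y \<in> H\<close> unfolding H_def ops by blast
    qed (auto simp: H_def)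
    fix x y z assume x: "x \<in> carrier ?G" and "y \<in> H" "z \<in> H" "y \<le> x \<and> x \<le> z"
    then obtain m n where "- vb (d ^ m) \<le> y" "z \<le> vb (d ^ n)" unfolding H_def by blast
    then have "- vb (d ^ (m + n)) \<le> x \<and> x \<le> vb (d ^ (m + n))"
      using mono[of m n] mono[of n m] \<open>y \<le> x \<and> x \<le> z\<close>
      by (simp add: add.commute) (meson le_imp_neg_le order_trans)
    then show "x \<in> H" using x unfolding H_def by blast
  qed
  moreover have "convex_subgroup {0} ?G"
    using G.triv_subgroup by (auto simp: convex_subgroup_def ops)
  moreover have "vb d \<in> H"
    using mem[OF d(1,2)] d unfolding H_def by (auto intro!: exI[of _ 1] simp: less_imp_le order_trans[of _ 0])
  then have "H \<noteq> {0}" and "carrier ?G \<noteq> {0}" using d mem[OF d(1,2)] by auto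
  moreover obtain H0 where "{H. convex_subgroup H ?G \<and> H \<noteq> carrier ?G} = {H0}"
    using rank unfolding rank_one_def One_nat_def card_1_singleton_iff by blast
  ultimately have "H = carrier ?G" by (metis (mono_tags, lifting) mem_Collect_eq singletonD)
  then obtain m where m: "vb e \<le> vb (d ^ m)" using mem[OF e] unfolding H_def by blast
  \<comment> \<open>One more factor \<open>d\<close> makes the bound strict.\<close>
  also have "\<dots> < vb (d ^ Suc m)" using d by (simp add: val_mult)
  finally show ?thesis by blast
qed

text \<open>Suitable powers of \<open>y\<close> and \<open>z\<close> have values in the value group
  of \<open>K\<close>, where rank one applies.\<close>

lemma archimedean_if_algebraic:
  assumes K: "closed_field_set K" and rank: "rank_one K vb" and alg: "\<And>x. algebraic_over K x"
    and y: "y \<noteq> 0" "0 < vb y" and z: "z \<noteq> 0"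
  shows "\<exists>m. vb z < vb (y ^ m)"
proof (cases "0 < vb z")
  case True
  obtain n d where n: "n > 0" "d \<in> K" "d \<noteq> 0" "vb (y ^ n) = vb d"
    using value_torsion[OF K alg y(1)] by blast
  obtain k e where k: "k > 0" "e \<in> K" "e \<noteq> 0" "vb (z ^ k) = vb e"
    using value_torsion[OF K alg z] by blast
  have "0 < vb d" using val_power_pos[OF y n(1)] n by simp
  then obtain m where m: "vb e < vb (d ^ m)"
    using archimedean_if_rank_one[OF K rank n(2,3)] k by blast
  obtain j where "k = Suc j" using k(1) gr0_implies_Suc by blast
  then have "vb z \<le> vb (z ^ k)" using val_power_nonneg[of z j] z True by (simp add: val_mult less_imp_le)
  also have "\<dots> < vb (d ^ m)" using m k by simp
  also have "\<dots> = vb ((y ^ n) ^ m)" using n y by (intro val_power_eq_cong) auto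
  finally show ?thesis by (metis power_mult)
next
  case False
  then show ?thesis using y by (intro exI[of _ 1]) auto
qed

text \<open>Adding a factor to a product \<open>p\<close> uses
  \<open>(1 + f) p - 1 = (1 + f) (p - 1) + f\<close>, where \<open>1 + f\<close> has value
  0.\<close>

lemma unit_prod:
  assumes "0 \<le> \<delta>" "\<And>y. y \<in># A \<Longrightarrow> small \<delta> (f y)"
  shows "small \<delta> ((\<Prod>y\<in>#A. 1 + f y) - 1)"
  using assms(2)
proof (induction A)
  case (add y A)
  let ?p = "\<Prod>y\<in>#A. 1 + f y"
  have p: "small \<delta> (?p - 1)" using add by simp
  have "small 0 (f y)" using add.prems by (intro small_mono[OF _ assms(1)]) simp
  from val_add_small[of 1, simplified, OF this] have "small (\<delta> + vb (1 + f y)) ((1 + f y) * (?p - 1))"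
    "vb (1 + f y) = 0"
    using small_mult_left[of "1 + f y" \<delta> "?p - 1"] p by auto
  then have "small \<delta> ((1 + f y) * (?p - 1) + f y)" using small_add add.prems by simp
  then show ?case by (simp add: algebra_simps)
qed simp

lemma unit_quotient:
  assumes "0 \<le> \<delta>" "small \<delta> (x - 1)" "small \<delta> (y - 1)"
  shows "small \<delta> (x / y - 1)"
proof -
  have "small (vb 1) (y - 1)" using small_mono assms by simp
  from val_add_small[OF _ this] have y: "y \<noteq> 0" "vb y = 0" by auto
  have "y * (x / y - 1) = (x - 1) - (y - 1)" using y by (simp add: field_simps)
  then show ?thesis using small_diff[OF assms(2,3)] small_mult_left[OF y(1), of \<delta> "x / y - 1"] y by simp
qed

lemma val_prod_mset:
  "(\<And>y. y \<in># A \<Longrightarrow> f y \<noteq> 0) \<Longrightarrow> vb (\<Prod>y\<in>#A. f y) = (\<Sum>y\<in>#A. vb (f y))"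
proof (induction A)
  case (add y A)
  then have "(\<Prod>y\<in>#A. f y) \<noteq> 0" by (auto simp: prod_mset_zero_iff)
  then show ?case using add by (simp add: val_mult)
qed simp

text \<open>
  As \<open>m\<close> grows, a factor of the norm \<open>\<Prod>y. 1 + u y ^ m\<close> behaves like \<open>u y ^ m\<close> if \<open>vb (u y) < 0\<close> and
  like \<open>1\<close> if \<open>vb (u y) > 0\<close>; so quotients of consecutive norms converge to the product of the
  large \<open>u y\<close>.
\<close>

lemma large_factor_in_closure:
  assumes K: "closed_field_set K"
    and arch: "\<And>y z. y \<noteq> 0 \<Longrightarrow> 0 < vb y \<Longrightarrow> z \<noteq> 0 \<Longrightarrow> \<exists>m. vb z < vb (y ^ m)"
    and u: "\<And>y. y \<in># A \<Longrightarrow> u y \<noteq> 0 \<and> vb (u y) \<noteq> 0"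
    and norm: "\<And>m. (\<Prod>y\<in>#A. 1 + u y ^ m) \<in> K"
  shows "(\<Prod>y\<in>#A. if vb (u y) < 0 then u y else 1) \<in> closure_of_sub K" (is "?U \<in> _")
  unfolding closure_of_sub_def
proof (intro CollectI allI impI)
  interpret closed_field_set K by fact
  fix c :: 'a assume "c \<noteq> 0"
  \<comment> \<open>Whichever of \<open>u y\<close> and its inverse has positive value, so that its
    powers tend to 0.\<close>
  define e where "e y = (if vb (u y) < 0 then inverse (u y) else u y)" for y
  have e: "e y \<noteq> 0" "0 < vb (e y)" if "y \<in># A" for y
    using u[OF that] by (auto simp: e_def val_inverse)
  have U: "?U \<noteq> 0" using u by (auto simp: prod_mset_zero_iff)
  \<comment> \<open>The radius for \<open>c / ?U\<close>, since the error gets multiplied by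
    \<open>?U\<close>; it is raised to 0 if negative, as the estimates for units near 1
    require.\<close>
  define z where "z = (if 0 \<le> vb (c / ?U) then c / ?U else 1)"
  have z: "z \<noteq> 0" "0 \<le> vb z" "vb (c / ?U) \<le> vb z" using \<open>c \<noteq> 0\<close> U by (auto simp: z_def)
  have ev: "eventually (\<lambda>m. small (vb z) (e y ^ m)) sequentially" if "y \<in># A" for y
  proof -
    obtain m where m: "vb z < vb (e y ^ m)" using arch[OF _ _ z(1)] e \<open>y \<in># A\<close> by blast
    have "vb (e y ^ m) \<le> vb (e y ^ n)" if "m \<le> n" for n
      using that \<open>y \<in># A\<close> val_power_nonneg[of "e y" "n - m"] e[of y]
        val_mult[of "e y ^ m" "e y ^ (n - m)"] by (simp flip: power_add)
    then show ?thesis unfolding eventually_sequentially small_def using m by (meson less_le_trans)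
  qed
  have "eventually (\<lambda>m. \<forall>y\<in>set_mset A. small (vb z) (e y ^ m)) sequentially"
    by (rule eventually_ball_finite) (use ev in auto)
  then obtain m where m: "\<And>n y. n \<ge> m \<Longrightarrow> y \<in># A \<Longrightarrow> small (vb z) (e y ^ n)"
    unfolding eventually_sequentially by blast
  define N Q where "N n = (\<Prod>y\<in>#A. 1 + u y ^ n)" and "Q n = (\<Prod>y\<in>#A. 1 + e y ^ n)" for n
  \<comment> \<open>Pulling \<open>u y ^ n\<close> out of each large factor leaves
    \<open>1 + u y ^ (-n)\<close>. Hence \<open>N (Suc m) / N m\<close> is \<open>?U\<close> times a
    quotient of units near 1.\<close>
  have N: "N n = ?U ^ n * Q n" for n
  proof -
    have "(\<Prod>y\<in>#B. 1 + u y ^ n) = (\<Prod>y\<in>#B. if vb (u y) < 0 then u y else 1) ^ n * (\<Prod>y\<in>#B. 1 + e y ^ n)"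
      if "B \<subseteq># A" for B
      using that
    proof (induction B)
      case (add y B)
      then have "y \<in># A" "B \<subseteq># A" by (auto dest: mset_subset_eq_insertD)
      moreover have "1 + u y ^ n = (if vb (u y) < 0 then u y else 1) ^ n * (1 + e y ^ n)"
        using u[OF \<open>y \<in># A\<close>] by (auto simp: e_def field_simps)
      ultimately show ?case using add.IH by (simp add: power_mult_distrib)
    qed simp
    then show ?thesis by (simp add: N_def Q_def)
  qed
  have Q: "small (vb z) (Q n - 1)" if "n \<ge> m" for n
    unfolding Q_def using m that by (intro unit_prod z(2)) auto
  have "Q m \<noteq> 0" using val_add_small(1)[of 1 "Q m - 1"] small_mono[OF Q[of m] z(2)] by simp
  then have eq: "N (Suc m) / N m - ?U = ?U * (Q (Suc m) / Q m - 1)"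
    using U by (simp add: N field_simps)
  have "small (vb (c / ?U)) (Q (Suc m) / Q m - 1)"
    using unit_quotient[OF z(2) Q Q, of "Suc m" m] small_mono z(3) by simp
  then have "small (vb (c / ?U) + vb ?U) (N (Suc m) / N m - ?U)"
    unfolding eq using small_mult_left[OF U] by blast
  then have "small (vb c) (N (Suc m) / N m - ?U)" using U \<open>c \<noteq> 0\<close> by (simp add: val_divide)
  then show "\<exists>k\<in>K. small (vb c) (k - ?U)" using norm unfolding N_def by (blast intro: divide_mem)
qed

end

lemma sum_mset_strict_mono_ex:
  fixes f g :: "'b \<Rightarrow> 'g :: ordered_cancel_comm_monoid_add"
  assumes "\<And>y. y \<in># A \<Longrightarrow> f y \<le> g y" "x \<in># A" "f x < g x"
  shows "(\<Sum>y\<in>#A. f y) < (\<Sum>y\<in>#A. g y)"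
proof -
  obtain B where "A = add_mset x B" using assms(2) by (metis insert_DiffM)
  then show ?thesis using assms by (auto intro!: add_less_le_mono sum_mset_mono)
qed

text \<open>The midpoint between \<open>vb x\<close> and the next larger value on \<open>A\<close>
  separates the two and is not attained on \<open>A\<close>. A suitable multiple of it is the value
  of an element of \<open>K\<close>.\<close>

lemma separating_value:
  fixes vb :: "'a :: field \<Rightarrow> 'g :: linordered_ab_group_add"
  assumes vb: "full_valuation vb" and K: "closed_field_set K" and alg: "\<And>x. algebraic_over K x"
    and A: "finite A" "0 \<notin> A" "x \<in> A" "x' \<in> A" "vb x < vb x'"
  obtains q d where "d \<in> K" "d \<noteq> 0" "vb (x ^ q) < vb d" "vb d < vb (x' ^ q)"
    "\<And>y. y \<in> A \<Longrightarrow> vb (y ^ q) \<noteq> vb d"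
proof -
  interpret full_valuation vb by fact
  interpret closed_field_set K by fact
  let ?S = "{y \<in> A. vb x < vb y}"
  have S: "finite (vb ` ?S)" "vb ` ?S \<noteq> {}" using A by auto
  obtain z where z: "Min (vb ` ?S) = vb z" "z \<in> ?S" by (rule imageE[OF Min_in[OF S]])
  have min: "vb z \<le> vb y" if "y \<in> ?S" for y
    unfolding z(1)[symmetric] using S(1) that by (intro Min_le) auto
  have nz: "x \<noteq> 0" "z \<noteq> 0" using A z by auto
  obtain n1 d1 where 1: "n1 > 0" "d1 \<in> K" "d1 \<noteq> 0" "vb (x ^ n1) = vb d1"
    using value_torsion[OF K alg nz(1)] by blast
  obtain n2 d2 where 2: "n2 > 0" "d2 \<in> K" "d2 \<noteq> 0" "vb (z ^ n2) = vb d2"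
    using value_torsion[OF K alg nz(2)] by blast
  define n where "n = n1 * n2"
  \<comment> \<open>\<open>x ^ n\<close> and \<open>z ^ n\<close> both have values from
    \<open>K\<close>, and \<open>d\<close> has the sum of these as its value: \<open>q = 2 n\<close>
    times the midpoint.\<close>
  define q d where "q = n + n" and "d = d1 ^ n2 * d2 ^ n1"
  have "vb (x ^ n) = vb (d1 ^ n2)" "vb (z ^ n) = vb (d2 ^ n1)"
    using val_power_eq_cong[OF _ 1(3,4), of n2] val_power_eq_cong[OF _ 2(3,4), of n1] nz
    by (simp_all add: n_def power_mult[symmetric] mult.commute)
  then have vd: "vb d = vb (x ^ n) + vb (z ^ n)" using 1 2 by (simp add: d_def val_mult)
  have less: "vb (x ^ n) < vb (z ^ n)" using val_power_strict_mono[OF nz, of n] z 1 2 by (simp add: n_def)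
  have vq: "vb (y ^ q) = vb (y ^ n) + vb (y ^ n)" if "y \<noteq> 0" for y
    using that by (simp add: q_def power_add val_mult)
  have lo: "vb (y ^ q) < vb d" if "y \<in> A" "vb y \<le> vb x" for y
  proof -
    have y: "y \<noteq> 0" using that A by auto
    have "vb (y ^ n) \<le> vb (x ^ n)" using val_power_mono[OF y nz(1) that(2)] .
    then show ?thesis unfolding vd vq[OF y] using less by (intro add_le_less_mono) auto
  qed
  have hi: "vb d < vb (y ^ q)" if "y \<in> A" "vb x < vb y" for y
  proof -
    have y: "y \<noteq> 0" using that A by auto
    have "vb (z ^ n) \<le> vb (y ^ n)" using val_power_mono[OF nz(2) y] min[of y] that by simp
    then show ?thesis unfolding vd vq[OF y] using less by (intro add_less_le_mono) auto
  qed
  show ?thesis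
  proof (rule that[of d q])
    show "d \<in> K" "d \<noteq> 0" using 1 2 by (auto simp: d_def intro: mult_mem power_mem)
    show "vb (x ^ q) < vb d" "vb d < vb (x' ^ q)" using lo[of x] hi[of x'] A by auto
    show "vb (y ^ q) \<noteq> vb d" if "y \<in> A" for y using lo[of y] hi[of y] that by fastforce
  qed
qed

text \<open>The value of \<open>?U\<close> is the sum of the negative values of \<open>u\<close> on
  the roots. Applying \<open>\<tau>\<close> fixes \<open>?U\<close> but would give a strictly larger
  sum.\<close>

lemma rank_one_invariant:
  fixes vb :: "'a :: alg_closed_field \<Rightarrow> 'g :: linordered_ab_group_add"
  assumes vb: "full_valuation vb" and K: "closed_field_set K" and rank: "rank_one K vb"
    and alg: "\<And>x. algebraic_over K x"
    and \<tau>: "field_endo (full_valuation.closure_of_sub vb K) \<tau>" and x: "x \<noteq> 0"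
  shows "vb (\<tau> x) = vb x"
proof (rule ccontr)
  assume neq: "vb (\<tau> x) \<noteq> vb x"
  interpret full_valuation vb by fact
  interpret closed_field_set K by fact
  interpret L: field_endo "closure_of_sub K" \<tau> by fact
  \<comment> \<open>\<open>\<tau>\<close> also fixes the smaller field \<open>K\<close>, so it
    permutes the roots of polynomials over \<open>K\<close>.\<close>
  interpret field_endo K \<tau>
    by unfold_locales (auto intro: L.hom_add L.hom_mult L.fixes_base subsetD[OF closure_of_sub_incl] alg)
  obtain g where g: "is_min_poly K x g" using min_poly_exists alg by blast
  have gK: "g \<in> polys_over K" "Polynomial.lead_coeff g = 1" "poly g x = 0" "g \<noteq> 0"
    using g by (auto simp: is_min_poly_def)
  let ?A = "proots g"
  have im: "image_mset \<tau> ?A = ?A" by (rule image_proots[OF field_endo_axioms gK(1,2)])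
  have mem: "x \<in># ?A" using gK by simp
  have mem': "\<tau> y \<in># ?A" if "y \<in># ?A" for y using that im by (metis image_eqI set_image_mset)
  have "0 \<notin># ?A" using min_poly_coeff_0[OF g x] gK by (simp add: poly_0_coeff_0)
  then have nz: "y \<noteq> 0" if "y \<in># ?A" for y using that by metis
  \<comment> \<open>Either of \<open>x\<close> and \<open>\<tau> x\<close> may have the smaller
    value; the equivalence with a negation covers both cases.\<close>
  have sep: "\<exists>q d. d \<in> K \<and> d \<noteq> 0 \<and> (\<forall>y\<in>#?A. vb (y ^ q) \<noteq> vb d) \<and>
    (vb (x ^ q) < vb d \<longleftrightarrow> \<not> vb (\<tau> x ^ q) < vb d)"
  proof (cases "vb x < vb (\<tau> x)")
    case True
    from separating_value[OF vb K alg finite_set_mset \<open>0 \<notin># ?A\<close> mem mem'[OF mem] True] show ?thesis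
      by (metis less_asym)
  next
    case False
    then have "vb (\<tau> x) < vb x" using neq by simp
    from separating_value[OF vb K alg finite_set_mset \<open>0 \<notin># ?A\<close> mem'[OF mem] mem this] show ?thesis
      by (metis less_asym)
  qed
  then obtain q d where d: "d \<in> K" "d \<noteq> 0" and ne: "\<And>y. y \<in># ?A \<Longrightarrow> vb (y ^ q) \<noteq> vb d"
    and split: "vb (x ^ q) < vb d \<longleftrightarrow> \<not> vb (\<tau> x ^ q) < vb d" by blast
  define u where "u y = y ^ q / d" for y
  have u: "u y \<noteq> 0" "vb (u y) = vb (y ^ q) - vb d" if "y \<in># ?A" for y
    using nz[OF that] d by (auto simp: u_def val_divide)
  have u\<tau>: "u (\<tau> y) = \<tau> (u y)" for y
    using d by (simp add: u_def hom_divide hom_power fixes_base)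
  define f where "f y = vb (u y)" for y
  have f: "f y \<noteq> 0" if "y \<in># ?A" for y using u(2)[OF that] ne[OF that] by (simp add: f_def)
  let ?U = "\<Prod>y\<in>#?A. if f y < 0 then u y else 1"
  have U: "?U \<in> closure_of_sub K"
    unfolding f_def
  proof (rule large_factor_in_closure[OF K archimedean_if_algebraic[OF K rank alg]])
    show "u y \<noteq> 0 \<and> vb (u y) \<noteq> 0" if "y \<in># ?A" for y using u f that by (simp add: f_def)
    fix m
    \<comment> \<open>Since \<open>d \<in> K\<close>, the factor \<open>1 + u y ^ m\<close> is a
      polynomial over \<open>K\<close> evaluated at \<open>y\<close>, so the product is a
      norm.\<close>
    let ?h = "1 + Polynomial.monom (inverse d) q ^ m"
    have "poly ?h y = 1 + u y ^ m" for y
      by (simp add: poly_monom u_def divide_inverse mult.commute)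
    moreover have "?h \<in> polys_over K"
      by (intro polys_over_add polys_over_power polys_over_monom inverse_mem d polys_over_1)
    ultimately show "(\<Prod>y\<in>#?A. 1 + u y ^ m) \<in> K" using norm_mem[OF K gK(1,4), of ?h] by simp
  qed
  have "(\<Sum>y\<in>#?A. if f y < 0 then f y else 0) = vb ?U"
    using u(1) by (subst val_prod_mset) (auto simp: f_def intro!: arg_cong[where f = sum_mset] image_mset_cong)
  also have "\<dots> = vb (\<tau> ?U)" using L.fixes_base[OF U] by simp
  also have "\<tau> ?U = (\<Prod>y\<in>#?A. if f y < 0 then u (\<tau> y) else 1)"
    unfolding hom_prod_mset by (intro arg_cong[where f = prod_mset] image_mset_cong) (simp add: u\<tau>)
  also have "vb \<dots> = (\<Sum>y\<in>#?A. if f y < 0 then f (\<tau> y) else 0)"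
    using u(1)[OF mem'] by (subst val_prod_mset) (auto simp: f_def intro!: arg_cong[where f = sum_mset] image_mset_cong)
  \<comment> \<open>Selecting by the sign of \<open>f (\<tau> y)\<close> itself keeps exactly the
    negative values and so gives the least sum. At \<open>x\<close> the two selections
    differ.\<close>
  also have "\<dots> > (\<Sum>y\<in>#?A. if f (\<tau> y) < 0 then f (\<tau> y) else 0)"
  proof (rule sum_mset_strict_mono_ex[OF _ mem])
    show "(if f (\<tau> y) < 0 then f (\<tau> y) else 0) \<le> (if f y < 0 then f (\<tau> y) else 0)" for y by auto
    have "f x < 0 \<longleftrightarrow> \<not> f (\<tau> x) < 0" using split u(2)[OF mem] u(2)[OF mem'[OF mem]] by (simp add: f_def)
    then show "(if f (\<tau> x) < 0 then f (\<tau> x) else 0) < (if f x < 0 then f (\<tau> x) else 0)"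
      using f[OF mem'[OF mem]] by auto
  qed
  \<comment> \<open>Reindexing the roots along \<open>\<tau>\<close> returns to the initial
    sum.\<close>
  also have "(\<Sum>y\<in>#?A. if f (\<tau> y) < 0 then f (\<tau> y) else 0) = (\<Sum>y\<in>#?A. if f y < 0 then f y else 0)"
    by (subst (2) im[symmetric]) (simp add: image_mset.compositionality o_def)
  finally show False by simp
qed

section \<open>Conjugates over the henselization and over the topological closure\<close>

theorem corollary3p3:
  fixes K Kh :: "'a :: alg_closed_field set"
    and v vb :: "'a \<Rightarrow> 'g :: linordered_ab_group_add"
    and w :: "'a poly fract \<Rightarrow> 'g"
    and a :: 'a and \<gamma> :: 'g
  assumes closure: "algebraic_closure (ring_of_type_algebra :: 'a ring) K"
    and v: "valued_field K v"
    and vb: "valued_field UNIV vb" "agree_on K vb v"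
    and w: "valued_field (rat_funs K) w" "agree_on K (w \<circ> const_fun) v"
    and transcendental: "valuation_transcendental (const_fun ` K) (rat_funs K) w"
    and minimal: "minimal_pair_of_definition K vb w a \<gamma>"
    and not_infinite: "henselian vb K \<or> (\<exists>c. c \<noteq> 0 \<and> \<gamma> \<le> vb c)"
  shows "(is_henselization vb K Kh \<and> dense_in vb K Kh \<longrightarrow>
            (\<forall>a'. conjugate_over K a a' \<longrightarrow> pair_of_definition K vb w a' \<gamma>)) \<and>
         (rank_one K v \<longrightarrow>
            (\<forall>a'. conjugate_over K a a' \<longrightarrow> pair_of_definition K vb w a' \<gamma>))"
proof -
  have K: "closed_field_set K"
    using v by (simp add: valued_field_def subfield_type_ring_iff)
  interpret closed_field_set K by fact
  have alg: "algebraic_over K x" for x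
    using algebraic_closure.algebraic_extension[OF closure] by (intro algebraic_over_if_algebraic) simp
  interpret vb: valued_field UNIV vb by fact
  have fv: "full_valuation vb"
    by unfold_locales (use vb.val_mult vb.val_add in auto)
  interpret full_valuation vb by fact
  have henselian_inv: "vb (\<tau> x) = vb x" if "henselian vb L" "field_endo L \<tau>" "x \<noteq> 0" for L \<tau> x
  proof -
    interpret \<tau>: field_endo L \<tau> by fact
    \<comment> \<open>\<open>vb \<circ> \<tau>\<close> is another extension of the valuation of
      \<open>L\<close>, so it equals \<open>vb\<close> when \<open>L\<close> is henselian.\<close>
    have "valued_field UNIV (vb \<circ> \<tau>)"
    proof (rule valued_field.intro)
      show "min ((vb \<circ> \<tau>) x) ((vb \<circ> \<tau>) y) \<le> (vb \<circ> \<tau>) (x + y)" if "x \<noteq> 0" "y \<noteq> 0" "x + y \<noteq> 0" for x y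
        using val_add[of "\<tau> x" "\<tau> y"] \<tau>.hom_eq_0_iff[of "x + y"] that by (simp add: \<tau>.hom_add)
    qed (use vb.is_subfield in \<open>auto simp: \<tau>.hom_mult val_mult\<close>)
    moreover have "agree_on L (vb \<circ> \<tau>) vb" by (simp add: agree_on_def \<tau>.fixes_base)
    ultimately have "agree_on UNIV (vb \<circ> \<tau>) vb" using that(1) unfolding henselian_def by blast
    then show ?thesis using that(3) by (simp add: agree_on_def)
  qed
  note result = conjugates_of_minimal_pair[OF fv K _ _ alg _ _ minimal]
  have henselian_case: "pair_of_definition K vb w a' \<gamma>" if "henselian vb K" "conjugate_over K a a'" for a'
    by (rule result[OF K]) (use that henselian_inv in auto)
  have "pair_of_definition K vb w a' \<gamma>"
    if h: "is_henselization vb K Kh" and dense: "dense_in vb K Kh" and a': "conjugate_over K a a'" for a'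
  proof (cases "henselian vb K")
    case False
    have L: "closed_field_set Kh" "K \<subseteq> Kh" "henselian vb Kh"
      using h by (auto simp: is_henselization_def subfield_type_ring_iff)
    have "dense_sub K Kh"
      unfolding dense_sub_def
    proof (intro ballI allI impI)
      fix x c assume "x \<in> Kh" "c \<noteq> (0 :: 'a)"
      obtain n d where n: "n > 0" "d \<in> K" "d \<noteq> 0" "vb (c ^ n) = vb d"
        using value_torsion[OF K alg \<open>c \<noteq> 0\<close>] by blast
      \<comment> \<open>\<open>dense_in\<close> allows only radii that are values on
        \<open>Kh\<close>, \<open>dense_sub\<close> all values of the closure. For
        \<open>vb c \<ge> 0\<close> the multiple \<open>vb d\<close> of \<open>vb c\<close> is at
        least \<open>vb c\<close>; for negative \<open>vb c\<close> radius 0 suffices.\<close>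
      define e where "e = (if 0 \<le> vb c then d else 1)"
      have e: "e \<in> Kh" "e \<noteq> 0" using n L(2) one_mem by (auto simp: e_def)
      obtain k where "n = Suc k" using n(1) gr0_implies_Suc by blast
      then have "vb c \<le> vb e"
        using n(4) val_power_nonneg[of c k] \<open>c \<noteq> 0\<close> by (auto simp: e_def val_mult simp flip: n(4))
      moreover obtain l where "l \<in> K" "small (vb e) (l - x)"
        using dense \<open>x \<in> Kh\<close> e unfolding dense_in_def small_def by blast
      ultimately show "\<exists>k\<in>K. small (vb c) (k - x)" using small_mono by blast
    qed
    then have "Kh = K \<or> dense_sub K Kh \<and> (\<exists>c. c \<noteq> 0 \<and> \<gamma> \<le> vb c)" using not_infinite False by blast
    from result[OF L(1,2) _ this a'] henselian_inv[OF L(3)] show ?thesis by blast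
  qed (use henselian_case a' in auto)
  moreover have "pair_of_definition K vb w a' \<gamma>"
    if rank: "rank_one K v" and a': "conjugate_over K a a'" for a'
  proof (cases "henselian vb K")
    case False
    \<comment> \<open>The rank is given for \<open>v\<close> and needed for \<open>vb\<close>; both
      have the same values on \<open>K\<close>.\<close>
    have "v ` (K - {0}) = vb ` (K - {0})"
      using vb(2) by (intro image_cong) (auto simp: agree_on_def)
    then have "rank_one K vb" using rank by (simp add: rank_one_def value_group_def)
    note inv = rank_one_invariant[OF fv K this alg]
    have "closure_of_sub K = K \<or> dense_sub K (closure_of_sub K) \<and> (\<exists>c. c \<noteq> 0 \<and> \<gamma> \<le> vb c)"
      using not_infinite False dense_closure_of_sub by blast
    from result[OF closed_field_set_closure[OF K] closure_of_sub_incl _ this a'] inv show ?thesis by blast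
  qed (use henselian_case a' in auto)
  ultimately show ?thesis by blast
qed

end
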